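(* Let $(R,\mathfrak m)$ be a two-dimensional Cohen–Macaulay local ring with infinite residue field, $I$ an $\mathfrak m$-primary ideal, and $x\in I$ a superficial element for $I$. If $\operatorname{n}(I)\neq\rho(I)-1$, then $\operatorname{rd}(I)\ge\operatorname{n}(I)+2$.
   Context: $H_I(n)=\lambda(R/I^n)$ is the Hilbert–Samuel function, $P_I$ the Hilbert–Samuel polynomial, and $\operatorname{n}(I)=\min\{n\in\mathbb Z:P_I(t)=H_I(t)\text{ for all }t>n\}$ the postulation number. The Ratliff–Rush closure of an ideal $K$ is $\widetilde K=\bigcup_{n\ge1}(K^{n+1}:K^n)$, and $\rho(I)=\min\{i\ge1:\widetilde{I^n}=I^n\text{ for all }n\ge i\}$. A reduction of $I$ is an ideal $J\subseteq I$ with $JI^n=I^{n+1}$ for some $n$; $\operatorname{rd}_J(I)$ is the least such $n$; a minimal reduction is one minimal under inclusion among reductions; $\operatorname{rd}(I)=\min\{\operatorname{rd}_J(I): J\text{ a minimal reduction of }I\}$. An element $x\in I$ is superficial for $I$ if there is $c>0$ with $(I^{n+1}:x)\cap I^c=I^n$ for all $n\ge c$. *)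

theory Defs
  imports Complex_Main "HOL-Computational_Algebra.Polynomial" "HOL-Library.Extended_Nat"
begin

definition is_ideal :: "'a::comm_ring_1 set \<Rightarrow> bool" where
  "is_ideal I \<longleftrightarrow> 0 \<in> I \<and> (\<forall>x\<in>I. \<forall>y\<in>I. x + y \<in> I) \<and> (\<forall>r. \<forall>x\<in>I. r * x \<in> I)"

definition ideal_gen :: "'a::comm_ring_1 set \<Rightarrow> 'a set" where
  "ideal_gen S = \<Inter>{J. is_ideal J \<and> S \<subseteq> J}"

definition iprod :: "'a::comm_ring_1 set \<Rightarrow> 'a set \<Rightarrow> 'a set" where
  "iprod I J = ideal_gen {a * b | a b. a \<in> I \<and> b \<in> J}"

primrec ipow :: "'a::comm_ring_1 set \<Rightarrow> nat \<Rightarrow> 'a set" where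
  "ipow I 0 = UNIV"
| "ipow I (Suc n) = iprod I (ipow I n)"

definition icolon :: "'a::comm_ring_1 set \<Rightarrow> 'a set \<Rightarrow> 'a set" where
  "icolon I J = {r. \<forall>x\<in>J. r * x \<in> I}"

definition prime_ideal :: "'a::comm_ring_1 set \<Rightarrow> bool" where
  "prime_ideal P \<longleftrightarrow> is_ideal P \<and> P \<noteq> UNIV \<and> (\<forall>a b. a * b \<in> P \<longrightarrow> a \<in> P \<or> b \<in> P)"

definition maximal_ideal :: "'a::comm_ring_1 set \<Rightarrow> bool" where
  "maximal_ideal m \<longleftrightarrow> is_ideal m \<and> m \<noteq> UNIV \<and>
     (\<forall>J. is_ideal J \<and> m \<subseteq> J \<longrightarrow> J = m \<or> J = UNIV)"

definition noetherian_ring :: "'a::comm_ring_1 itself \<Rightarrow> bool" where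
  "noetherian_ring _ \<longleftrightarrow> (\<forall>I::'a set. is_ideal I \<longrightarrow> (\<exists>F. finite F \<and> I = ideal_gen F))"

definition local_ring :: "'a::comm_ring_1 itself \<Rightarrow> bool" where
  "local_ring _ \<longleftrightarrow> (\<exists>!m::'a set. maximal_ideal m)"

definition krull_dim :: "'a::comm_ring_1 itself \<Rightarrow> enat" where
  "krull_dim _ = Sup (enat ` {n. \<exists>f :: nat \<Rightarrow> 'a set.
       (\<forall>i\<le>n. prime_ideal (f i)) \<and> (\<forall>i<n. f i \<subset> f (Suc i))})"

definition regular_seq :: "'a::comm_ring_1 list \<Rightarrow> bool" where
  "regular_seq xs \<longleftrightarrow> ideal_gen (set xs) \<noteq> UNIV \<and>
     (\<forall>i<length xs. \<forall>r. r * xs ! i \<in> ideal_gen (set (take i xs)) \<longrightarrow> r \<in> ideal_gen (set (take i xs)))"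

definition depth :: "'a::comm_ring_1 set \<Rightarrow> enat" where
  "depth m = Sup (enat ` {length xs | xs. set xs \<subseteq> m \<and> regular_seq xs})"

definition cohen_macaulay_local :: "'a::comm_ring_1 set \<Rightarrow> bool" where
  "cohen_macaulay_local m \<longleftrightarrow> noetherian_ring TYPE('a) \<and> local_ring TYPE('a) \<and>
     maximal_ideal m \<and> depth m = krull_dim TYPE('a)"

definition infinite_residue_field :: "'a::comm_ring_1 set \<Rightarrow> bool" where
  "infinite_residue_field m \<longleftrightarrow> infinite ((\<lambda>x. {x + y | y. y \<in> m}) ` UNIV)"

definition radical :: "'a::comm_ring_1 set \<Rightarrow> 'a set" where
  "radical I = {x. \<exists>n. x ^ n \<in> I}"

definition primary_to :: "'a::comm_ring_1 set \<Rightarrow> 'a set \<Rightarrow> bool" where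
  "primary_to m I \<longleftrightarrow> is_ideal I \<and> I \<noteq> UNIV \<and> radical I = m"

text \<open>Length of R/I as R-module: sup of lengths of strict chains of ideals
  I = J_0 \<subset> ... \<subset> J_n = R (these correspond to chains of submodules of R/I).\<close>
definition colength :: "'a::comm_ring_1 set \<Rightarrow> enat" where
  "colength I = Sup (enat ` {n. \<exists>f :: nat \<Rightarrow> 'a set. f 0 = I \<and> f n = UNIV \<and>
       (\<forall>i\<le>n. is_ideal (f i)) \<and> (\<forall>i<n. f i \<subset> f (Suc i))})"

text \<open>Hilbert--Samuel function on integers; I^n = R for n \<le> 0, so H(n) = 0 there.\<close>
definition hilbert_samuel :: "'a::comm_ring_1 set \<Rightarrow> int \<Rightarrow> int" where
  "hilbert_samuel I t = int (the_enat (colength (ipow I (nat t))))"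

definition hs_poly :: "'a::comm_ring_1 set \<Rightarrow> rat poly" where
  "hs_poly I = (THE P. \<forall>\<^sub>F t in at_top. poly P (of_int t) = of_int (hilbert_samuel I t))"

definition postulation :: "'a::comm_ring_1 set \<Rightarrow> int" where
  "postulation I = Inf {n :: int. \<forall>t > n. poly (hs_poly I) (of_int t) = of_int (hilbert_samuel I t)}"

definition ratliff_rush :: "'a::comm_ring_1 set \<Rightarrow> 'a set" where
  "ratliff_rush K = (\<Union>n\<in>{1..}. icolon (ipow K (Suc n)) (ipow K n))"

definition rr_index :: "'a::comm_ring_1 set \<Rightarrow> nat" where
  "rr_index I = (LEAST i. i \<ge> 1 \<and> (\<forall>n\<ge>i. ratliff_rush (ipow I n) = ipow I n))"

definition is_reduction :: "'a::comm_ring_1 set \<Rightarrow> 'a set \<Rightarrow> bool" where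
  "is_reduction J I \<longleftrightarrow> is_ideal J \<and> J \<subseteq> I \<and> (\<exists>n. iprod J (ipow I n) = ipow I (Suc n))"

definition red_number :: "'a::comm_ring_1 set \<Rightarrow> 'a set \<Rightarrow> nat" where
  "red_number J I = (LEAST n. iprod J (ipow I n) = ipow I (Suc n))"

definition minimal_reduction :: "'a::comm_ring_1 set \<Rightarrow> 'a set \<Rightarrow> bool" where
  "minimal_reduction J I \<longleftrightarrow> is_reduction J I \<and> (\<forall>K. is_reduction K I \<and> K \<subseteq> J \<longrightarrow> K = J)"

definition reduction_number :: "'a::comm_ring_1 set \<Rightarrow> nat" where
  "reduction_number I = (LEAST r. \<exists>J. minimal_reduction J I \<and> r = red_number J I)"

definition superficial :: "'a::comm_ring_1 set \<Rightarrow> 'a \<Rightarrow> bool" where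
  "superficial I x \<longleftrightarrow> x \<in> I \<and> (\<exists>c>0. \<forall>n\<ge>c.
      icolon (ipow I (Suc n)) {x} \<inter> ipow I c = ipow I n)"

end

theory Submission
  imports Defs
begin

text \<open>
  Let \<open>J = (a, b)\<close> be a minimal reduction of \<open>I\<close> with \<open>r = rd(I) = rd\<^sub>J(I)\<close>, and put \<open>n = n(I)\<close>.
  For \<open>t \<ge> r\<close> we have \<open>J I\<^sup>t = I\<^bsup>t+1\<^esup>\<close>, so Huneke's fundamental lemma reads
  \<open>H(t+1) - 2 H(t) + \<lambda>(R/(I\<^sup>t : J)) = \<lambda>(R/J)\<close>. The colon ideal lies in the Ratliff--Rush closure of
  \<open>I\<^bsup>t-1\<^esup>\<close>, which is \<open>I\<^bsup>t-1\<^esup>\<close> for large \<open>t\<close> by superficiality; hence \<open>H\<close> is eventually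
  a polynomial \<open>P\<close> with constant second difference \<open>\<lambda>(R/J)\<close>.

  Suppose \<open>r \<le> n + 1\<close>. Comparing \<open>H\<close> with \<open>P\<close> gives \<open>(I\<^sup>t : J) = I\<^bsup>t-1\<^esup>\<close> for all \<open>t \<ge> n + 2\<close>, and
  descending induction shows that \<open>I\<^sup>t\<close> is Ratliff--Rush closed for all \<open>t \<ge> n + 1\<close>. At \<open>t = n + 1\<close> the
  same comparison gives \<open>(I\<^bsup>n+1\<^esup> : J) \<noteq> I\<^sup>n\<close>, so \<open>I\<^sup>n\<close> is not Ratliff--Rush closed. Thus
  \<open>\<rho>(I) = n + 1\<close>, which is excluded.

  Every reduction contains one with two generators, as one of three generators can always be dropped after a
  linear change of variables: the monomials of degree \<open>k\<close> in them cannot be independent modulo \<open>m I\<^sup>k\<close> for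
  all \<open>k\<close>, since \<open>\<lambda>(R/I\<^sup>k)\<close> would then grow cubically, whereas a regular sequence \<open>(p, q)\<close> bounds it
  quadratically. Since no principal ideal is primary to \<open>m\<close>, two-generated reductions are minimal.
\<close>

section \<open>Ideal arithmetic\<close>

lemma ideal_zero: "is_ideal I \<Longrightarrow> 0 \<in> I"
  and ideal_add: "is_ideal I \<Longrightarrow> x \<in> I \<Longrightarrow> y \<in> I \<Longrightarrow> x + y \<in> I"
  and ideal_mult_left: "is_ideal I \<Longrightarrow> x \<in> I \<Longrightarrow> r * x \<in> I"
  by (auto simp: is_ideal_def)

lemma ideal_mult_right: "is_ideal I \<Longrightarrow> x \<in> I \<Longrightarrow> x * r \<in> I"
  using ideal_mult_left[of I x r] by (simp add: mult.commute)

lemma ideal_uminus: "is_ideal I \<Longrightarrow> x \<in> I \<Longrightarrow> - x \<in> I"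
  using ideal_mult_left[of I x "-1"] by simp

lemma ideal_diff: "is_ideal I \<Longrightarrow> x \<in> I \<Longrightarrow> y \<in> I \<Longrightarrow> x - y \<in> I"
  using ideal_add[of I x "- y"] ideal_uminus[of I y] by simp

lemma ideal_sum: "is_ideal I \<Longrightarrow> (\<And>s. s \<in> S \<Longrightarrow> f s \<in> I) \<Longrightarrow> sum f S \<in> I"
  by (induction S rule: infinite_finite_induct) (auto intro: ideal_zero ideal_add)

lemma ideal_UNIV: "is_ideal UNIV"
  by (auto simp: is_ideal_def)

lemma ideal_zero_set: "is_ideal {0}"
  by (auto simp: is_ideal_def)

lemma ideal_Int: "is_ideal I \<Longrightarrow> is_ideal J \<Longrightarrow> is_ideal (I \<inter> J)"
  by (auto simp: is_ideal_def)

lemma ideal_eq_UNIV: "is_ideal I \<Longrightarrow> 1 \<in> I \<Longrightarrow> I = UNIV"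
  using ideal_mult_left[of I 1] by auto

lemma ideal_gen_ideal: "is_ideal (ideal_gen S)"
  by (auto simp: ideal_gen_def is_ideal_def)

lemma ideal_gen_superset: "S \<subseteq> ideal_gen S"
  by (auto simp: ideal_gen_def)

lemma ideal_gen_least: "is_ideal I \<Longrightarrow> S \<subseteq> I \<Longrightarrow> ideal_gen S \<subseteq> I"
  by (auto simp: ideal_gen_def)

lemma ideal_gen_empty: "ideal_gen {} = {0}"
  using ideal_gen_least[OF ideal_zero_set, of "{}"] ideal_zero[OF ideal_gen_ideal, of "{}"] by auto

section \<open>Sums and multiples of ideals\<close>

definition isum :: "'a::comm_ring_1 set \<Rightarrow> 'a set \<Rightarrow> 'a set" where
  "isum A B = {a + b | a b. a \<in> A \<and> b \<in> B}"

definition smult_set :: "'a::comm_ring_1 \<Rightarrow> 'a set \<Rightarrow> 'a set" where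
  "smult_set b C = (\<lambda>c. b * c) ` C"

lemma isumI: "a \<in> A \<Longrightarrow> b \<in> B \<Longrightarrow> a + b \<in> isum A B"
  by (auto simp: isum_def)

lemma isumE: "z \<in> isum A B \<Longrightarrow> (\<And>a b. a \<in> A \<Longrightarrow> b \<in> B \<Longrightarrow> z = a + b \<Longrightarrow> P) \<Longrightarrow> P"
  by (auto simp: isum_def)

lemma isum_mono: "A \<subseteq> A' \<Longrightarrow> B \<subseteq> B' \<Longrightarrow> isum A B \<subseteq> isum A' B'"
  by (auto simp: isum_def)

lemma ideal_isum:
  assumes "is_ideal A" "is_ideal B"
  shows "is_ideal (isum A B)"
  unfolding is_ideal_def
proof (intro conjI ballI allI)
  show "0 \<in> isum A B"
    using isumI[OF ideal_zero[OF assms(1)] ideal_zero[OF assms(2)]] by simp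
next
  fix x y assume "x \<in> isum A B" "y \<in> isum A B"
  then obtain a b a' b' where "a \<in> A" "b \<in> B" "x = a + b" "a' \<in> A" "b' \<in> B" "y = a' + b'"
    by (auto simp: isum_def)
  then show "x + y \<in> isum A B"
    using isumI[of "a + a'" A "b + b'" B] assms by (auto intro: ideal_add simp: algebra_simps)
next
  fix r x assume "x \<in> isum A B"
  then obtain a b where "a \<in> A" "b \<in> B" "x = a + b"
    by (auto simp: isum_def)
  then show "r * x \<in> isum A B"
    using isumI[of "r * a" A "r * b" B] assms by (simp add: ideal_mult_left distrib_left)
qed

lemma isum_commute: "isum A B = isum B A"
  unfolding isum_def by (metis add.commute)

lemma isum_assoc: "isum (isum A B) C = isum A (isum B C)"
proof
  show "isum (isum A B) C \<subseteq> isum A (isum B C)"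
    by (intro subsetI, elim isumE) (simp add: add.assoc isumI)
  show "isum A (isum B C) \<subseteq> isum (isum A B) C"
    by (intro subsetI, elim isumE) (simp add: isumI flip: add.assoc)
qed

lemma isum_upper1: "is_ideal B \<Longrightarrow> A \<subseteq> isum A B"
  using isumI[OF _ ideal_zero] by fastforce

lemma isum_upper2: "is_ideal A \<Longrightarrow> B \<subseteq> isum A B"
  using isumI[OF ideal_zero] by fastforce

lemma isum_least: "is_ideal C \<Longrightarrow> A \<subseteq> C \<Longrightarrow> B \<subseteq> C \<Longrightarrow> isum A B \<subseteq> C"
  by (auto simp: isum_def intro!: ideal_add)

lemma isum_absorb1: "is_ideal A \<Longrightarrow> is_ideal B \<Longrightarrow> B \<subseteq> A \<Longrightarrow> isum A B = A"
  using isum_least[of A A B] isum_upper1[of B A] by auto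

lemma isum_absorb2: "is_ideal A \<Longrightarrow> is_ideal B \<Longrightarrow> A \<subseteq> B \<Longrightarrow> isum A B = B"
  using isum_least[of B A B] isum_upper2[of A B] by auto

lemma ideal_smult_set: "is_ideal C \<Longrightarrow> is_ideal (smult_set b C)"
  unfolding is_ideal_def smult_set_def
  by (auto simp: image_iff) (metis mult_zero_right, metis distrib_left, metis mult.left_commute)

lemma smult_set_UNIV_mem: "z \<in> smult_set g UNIV \<longleftrightarrow> (\<exists>r. z = g * r)"
  by (auto simp: smult_set_def)

lemma ideal_gen_insert: "ideal_gen (insert g S) = isum (smult_set g UNIV) (ideal_gen S)"
proof
  have i: "is_ideal (smult_set g UNIV)" by (rule ideal_smult_set[OF ideal_UNIV])
  have "g \<in> smult_set g UNIV" unfolding smult_set_UNIV_mem by (rule exI[of _ 1]) simp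
  then show "ideal_gen (insert g S) \<subseteq> isum (smult_set g UNIV) (ideal_gen S)"
    using isum_upper1[OF ideal_gen_ideal] isum_upper2[OF i] ideal_gen_superset[of S]
    by (intro ideal_gen_least ideal_isum i ideal_gen_ideal) blast
next
  have "g \<in> ideal_gen (insert g S)" "S \<subseteq> ideal_gen (insert g S)"
    using ideal_gen_superset[of "insert g S"] by auto
  then show "isum (smult_set g UNIV) (ideal_gen S) \<subseteq> ideal_gen (insert g S)"
    by (intro isum_least ideal_gen_least ideal_gen_ideal)
      (auto simp: smult_set_def intro: ideal_mult_right[OF ideal_gen_ideal])
qed

lemma ideal_gen_single: "ideal_gen {g} = smult_set g UNIV"
  by (simp add: ideal_gen_insert ideal_gen_empty isum_def)

lemma ideal_gen_pair_mem: "z \<in> ideal_gen {a, b} \<longleftrightarrow> (\<exists>r s. z = a * r + b * s)"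
  by (auto simp: ideal_gen_insert[of a] ideal_gen_single isum_def smult_set_def)

section \<open>Products of ideals\<close>

lemma ideal_iprod: "is_ideal (iprod A B)"
  unfolding iprod_def by (rule ideal_gen_ideal)

lemma iprodI: "a \<in> A \<Longrightarrow> b \<in> B \<Longrightarrow> a * b \<in> iprod A B"
  unfolding iprod_def by (rule subsetD[OF ideal_gen_superset]) auto

lemma iprod_least: "is_ideal C \<Longrightarrow> (\<And>a b. a \<in> A \<Longrightarrow> b \<in> B \<Longrightarrow> a * b \<in> C) \<Longrightarrow> iprod A B \<subseteq> C"
  unfolding iprod_def by (rule ideal_gen_least) auto

lemma iprod_mono: "A \<subseteq> A' \<Longrightarrow> B \<subseteq> B' \<Longrightarrow> iprod A B \<subseteq> iprod A' B'"
  by (intro iprod_least ideal_iprod iprodI) auto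

lemma iprod_commute: "iprod A B = iprod B A"
proof -
  have "iprod A B \<subseteq> iprod B A" for A B :: "'a set"
    by (intro iprod_least ideal_iprod) (subst mult.commute, rule iprodI)
  then show ?thesis by blast
qed

lemma iprod_subset_left: "is_ideal A \<Longrightarrow> iprod A B \<subseteq> A"
  by (intro iprod_least) (auto intro: ideal_mult_right)

lemma iprod_subset_right: "is_ideal B \<Longrightarrow> iprod A B \<subseteq> B"
  by (intro iprod_least) (auto intro: ideal_mult_left)

text \<open>Lets a containment of the form \<open>c\<close> times an ideal inside \<open>I\<close>
  be checked on generators of that ideal.\<close>

lemma ideal_preimage_mult: "is_ideal I \<Longrightarrow> is_ideal {z. c * z \<in> I}"
  by (auto simp: is_ideal_def distrib_left mult.left_commute)

lemma iprod_assoc: "iprod (iprod A B) C = iprod A (iprod B C)"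
proof -
  \<comment> \<open>One inclusion for all triples suffices; commutativity turns it into the
    other.\<close>
  have *: "iprod A (iprod B C) \<subseteq> iprod (iprod A B) C" for A B C :: "'a set"
  proof (rule iprod_least[OF ideal_iprod])
    fix a z assume a: "a \<in> A" and z: "z \<in> iprod B C"
    have "iprod B C \<subseteq> {z. a * z \<in> iprod (iprod A B) C}"
      using a by (intro iprod_least ideal_preimage_mult ideal_iprod)
        (auto simp flip: mult.assoc intro!: iprodI)
    with z show "a * z \<in> iprod (iprod A B) C" by blast
  qed
  have "iprod (iprod A B) C = iprod C (iprod B A)"
    by (simp add: iprod_commute)
  also have "\<dots> \<subseteq> iprod (iprod C B) A" by (rule *)
  also have "\<dots> = iprod A (iprod B C)"
    by (simp add: iprod_commute)
  finally show ?thesis using * by blast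
qed

lemma iprod_UNIV: "is_ideal A \<Longrightarrow> iprod A UNIV = A"
  using iprod_subset_left[of A UNIV] iprodI[of _ A 1 UNIV] by force

lemma UNIV_iprod: "is_ideal A \<Longrightarrow> iprod UNIV A = A"
  using iprod_UNIV[of A] by (simp add: iprod_commute)

lemma isum_iprod_subset:
  assumes "is_ideal A" "is_ideal B"
  shows "iprod (isum A B) C \<subseteq> isum (iprod A C) (iprod B C)"
  by (intro iprod_least ideal_isum ideal_iprod)
    (auto simp: distrib_right elim!: isumE intro!: isumI iprodI)

lemma smult_set_iprod_subset:
  assumes "is_ideal K"
  shows "iprod (smult_set a UNIV) K \<subseteq> smult_set a K"
proof (rule iprod_least[OF ideal_smult_set[OF assms]])
  fix z k assume "z \<in> smult_set a UNIV" "k \<in> K"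
  then show "z * k \<in> smult_set a K"
    by (auto simp: smult_set_def mult.assoc intro!: imageI ideal_mult_left[OF assms])
qed

lemma pair_iprod:
  assumes "is_ideal K"
  shows "iprod (ideal_gen {a, b}) K = isum (smult_set a K) (smult_set b K)"
proof
  have "iprod (ideal_gen {a, b}) K \<subseteq>
      isum (iprod (smult_set a UNIV) K) (iprod (smult_set b UNIV) K)"
    unfolding ideal_gen_insert[of a] ideal_gen_single
    by (intro isum_iprod_subset ideal_smult_set ideal_UNIV)
  also have "\<dots> \<subseteq> isum (smult_set a K) (smult_set b K)"
    by (intro isum_mono smult_set_iprod_subset assms)
  finally show "iprod (ideal_gen {a, b}) K \<subseteq> isum (smult_set a K) (smult_set b K)" .
next
  show "isum (smult_set a K) (smult_set b K) \<subseteq> iprod (ideal_gen {a, b}) K"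
    by (intro isum_least ideal_iprod)
      (auto simp: smult_set_def intro!: iprodI subsetD[OF ideal_gen_superset])
qed

section \<open>Powers and colons of ideals\<close>

lemma ideal_ipow: "is_ideal (ipow I n)"
  by (cases n) (auto intro: ideal_UNIV ideal_iprod)

lemma ipow_1: "is_ideal I \<Longrightarrow> ipow I (Suc 0) = I"
  by (simp add: iprod_UNIV)

lemma ipow_add: "ipow I (i + j) = iprod (ipow I i) (ipow I j)"
  by (induction i) (auto simp: UNIV_iprod[OF ideal_ipow] iprod_assoc)

lemma ipow_mult_mem: "a \<in> ipow I i \<Longrightarrow> b \<in> ipow I j \<Longrightarrow> a * b \<in> ipow I (i + j)"
  by (simp add: ipow_add iprodI)

lemma ipow_mem_power: "is_ideal I \<Longrightarrow> a \<in> I \<Longrightarrow> a ^ n \<in> ipow I n"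
  by (induction n) (auto intro: iprodI)

lemma ipow_decreasing: "i \<le> j \<Longrightarrow> ipow I j \<subseteq> ipow I i"
  using ipow_add[of I i "j - i"] iprod_subset_left[OF ideal_ipow] by simp

lemma ipow_mono: "I \<subseteq> J \<Longrightarrow> ipow I n \<subseteq> ipow J n"
  by (induction n) (simp_all add: iprod_mono)

lemma ipow_ipow: "ipow (ipow I i) j = ipow I (i * j)"
  by (induction j) (auto simp: ipow_add)

lemma ideal_icolon: "is_ideal I \<Longrightarrow> is_ideal (icolon I J)"
  unfolding is_ideal_def icolon_def by (auto simp: distrib_right mult.assoc)

lemma icolon_pair: 
  assumes "is_ideal K"
  shows "icolon K (ideal_gen {a, b}) = {z. z * a \<in> K} \<inter> {z. z * b \<in> K}"
proof -
  have "z * a \<in> K \<Longrightarrow> z * b \<in> K \<Longrightarrow> z * (a * r + b * s) \<in> K" for z r s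
    using ideal_add[OF assms ideal_mult_right[OF assms, of "z * a" r] ideal_mult_right[OF assms, of "z * b" s]]
    by (simp add: distrib_left mult.assoc)
  moreover have "a \<in> ideal_gen {a, b}" "b \<in> ideal_gen {a, b}"
    using ideal_gen_superset[of "{a, b}"] by auto
  ultimately show ?thesis
    by (auto simp: icolon_def ideal_gen_pair_mem)
qed

text \<open>Among \<open>i + j\<close> factors from \<open>K + L\<close> at least \<open>i\<close>
  come from \<open>K\<close> or at least \<open>j\<close> from \<open>L\<close>. The induction
  splits off one factor and lowers \<open>i\<close> or \<open>j\<close> accordingly.\<close>

lemma isum_ipow_subset:
  assumes "is_ideal K" "is_ideal L"
  shows "ipow (isum K L) (i + j) \<subseteq> isum (ipow K i) (ipow L j)"
proof (induction "i + j" arbitrary: i j)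
  case 0
  then show ?case by (simp add: isum_upper1 ideal_UNIV)
next
  case (Suc n)
  show ?case
  proof (cases "i = 0 \<or> j = 0")
    case True
    then show ?thesis
      using isum_upper1[OF ideal_ipow, of "ipow K i" L j] isum_upper2[OF ideal_ipow, of "ipow L j" K i] by auto
  next
    case False
    then obtain i' j' where ij: "i = Suc i'" "j = Suc j'" by (meson not0_implies_Suc)
    have n: "n = i' + j" "n = i + j'" using Suc(2) ij by auto
    have "ipow (isum K L) (i + j) = iprod (isum K L) (ipow (isum K L) n)"
      using Suc(2)[symmetric] by simp
    also have "\<dots> \<subseteq> isum (iprod K (ipow (isum K L) n)) (iprod L (ipow (isum K L) n))"
      by (rule isum_iprod_subset[OF assms])
    also have "\<dots> \<subseteq> isum (ipow K i) (ipow L j)"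
    proof (intro isum_least ideal_isum ideal_ipow)
      have "iprod K (ipow (isum K L) n) \<subseteq> iprod K (isum (ipow K i') (ipow L j))"
        using Suc(1)[OF n(1)] n(1) by (intro iprod_mono) auto
      also have "\<dots> = iprod (isum (ipow K i') (ipow L j)) K" by (rule iprod_commute)
      also have "\<dots> \<subseteq> isum (iprod (ipow K i') K) (iprod (ipow L j) K)"
        by (intro isum_iprod_subset ideal_ipow)
      also have "\<dots> \<subseteq> isum (ipow K i) (ipow L j)"
        by (intro isum_mono iprod_subset_left ideal_ipow) (simp add: ij iprod_commute)
      finally show "iprod K (ipow (isum K L) n) \<subseteq> isum (ipow K i) (ipow L j)" .
      have "iprod L (ipow (isum K L) n) \<subseteq> iprod L (isum (ipow K i) (ipow L j'))"
        using Suc(1)[OF n(2)] n(2) by (intro iprod_mono) auto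
      also have "\<dots> = iprod (isum (ipow K i) (ipow L j')) L" by (rule iprod_commute)
      also have "\<dots> \<subseteq> isum (iprod (ipow K i) L) (iprod (ipow L j') L)"
        by (intro isum_iprod_subset ideal_ipow)
      also have "\<dots> \<subseteq> isum (ipow K i) (ipow L j)"
        by (intro isum_mono iprod_subset_left ideal_ipow) (simp add: ij iprod_commute)
      finally show "iprod L (ipow (isum K L) n) \<subseteq> isum (ipow K i) (ipow L j)" .
    qed
    finally show ?thesis .
  qed
qed

lemma smult_UNIV_ipow: "ipow (smult_set g UNIV) n = smult_set (g ^ n) UNIV"
proof (induction n)
  case 0
  then show ?case by (auto simp: smult_set_def)
next
  case (Suc n)
  have "iprod (smult_set g UNIV) (smult_set (g ^ n) UNIV) \<subseteq> smult_set (g ^ Suc n) UNIV"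
    by (rule order.trans[OF smult_set_iprod_subset[OF ideal_smult_set[OF ideal_UNIV]]])
      (auto simp: smult_set_def mult.assoc)
  moreover have "smult_set (g ^ Suc n) UNIV \<subseteq> iprod (smult_set g UNIV) (smult_set (g ^ n) UNIV)"
  proof
    fix z assume "z \<in> smult_set (g ^ Suc n) UNIV"
    then obtain r where "z = (g * 1) * (g ^ n * r)" by (auto simp: smult_set_def mult.assoc)
    then show "z \<in> iprod (smult_set g UNIV) (smult_set (g ^ n) UNIV)"
      by (simp only:) (intro iprodI, unfold smult_set_def, blast+)
  qed
  ultimately show ?case using Suc by simp
qed

text \<open>Generators are added one at a time, the exponents summing up by
  \<open>isum_ipow_subset\<close>. It serves to find powers of \<open>m\<close>, and of the
  parameter ideal \<open>(p, q)\<close>, inside a given ideal.\<close>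

lemma ipow_gen_subset_of_powers:
  assumes "finite F" "is_ideal A" "\<And>f. f \<in> F \<Longrightarrow> \<exists>k. f ^ k \<in> A"
  shows "\<exists>N. ipow (ideal_gen F) N \<subseteq> A"
  using assms(1,3)
proof (induction F)
  case empty
  have "ipow (ideal_gen {}) (Suc 0) \<subseteq> A"
    using ipow_1[OF ideal_gen_ideal] ideal_zero[OF assms(2)] by (simp add: ideal_gen_empty iprod_UNIV ideal_zero_set)
  then show ?case by blast
next
  case (insert g F)
  obtain k where k: "g ^ k \<in> A" using insert by auto
  obtain N where N: "ipow (ideal_gen F) N \<subseteq> A" using insert by auto
  have "ipow (ideal_gen (insert g F)) (k + N) \<subseteq> isum (ipow (smult_set g UNIV) k) (ipow (ideal_gen F) N)"
    unfolding ideal_gen_insert by (intro isum_ipow_subset ideal_smult_set ideal_UNIV ideal_gen_ideal)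
  also have "\<dots> \<subseteq> A"
    unfolding smult_UNIV_ipow using k N
    by (intro isum_least assms) (auto simp: smult_set_def intro: ideal_mult_right[OF assms(2)])
  finally show ?case by blast
qed

section \<open>Lengths\<close>

text \<open>The strict chains behind \<open>colength\<close>, with an arbitrary upper end so that
  lengths can be added along inclusions.\<close>

inductive ichain :: "'a::comm_ring_1 set \<Rightarrow> 'a set \<Rightarrow> nat \<Rightarrow> bool" where
  ichain_refl: "is_ideal A \<Longrightarrow> ichain A A 0"
| ichain_step: "ichain A B n \<Longrightarrow> is_ideal C \<Longrightarrow> B \<subset> C \<Longrightarrow> ichain A C (Suc n)"

lemma ichain_ideals: "ichain A B n \<Longrightarrow> is_ideal A \<and> is_ideal B \<and> A \<subseteq> B"
  by (induction rule: ichain.induct) auto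

lemma ichain_iff:
  "ichain A B n \<longleftrightarrow> (\<exists>f. f 0 = A \<and> f n = B \<and> (\<forall>i\<le>n. is_ideal (f i)) \<and> (\<forall>i<n. f i \<subset> f (Suc i)))"
proof
  assume "ichain A B n"
  then show "\<exists>f. f 0 = A \<and> f n = B \<and> (\<forall>i\<le>n. is_ideal (f i)) \<and> (\<forall>i<n. f i \<subset> f (Suc i))"
  proof (induction rule: ichain.induct)
    case (ichain_refl A)
    then show ?case by (intro exI[of _ "\<lambda>_. A"]) auto
  next
    case (ichain_step A B n C)
    then obtain f where f: "f 0 = A" "f n = B" "\<forall>i\<le>n. is_ideal (f i)" "\<forall>i<n. f i \<subset> f (Suc i)"
      by blast
    then show ?case
      using ichain_step(2,3) by (intro exI[of _ "f(Suc n := C)"]) (auto simp: le_Suc_eq less_Suc_eq)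
  qed
next
  assume "\<exists>f. f 0 = A \<and> f n = B \<and> (\<forall>i\<le>n. is_ideal (f i)) \<and> (\<forall>i<n. f i \<subset> f (Suc i))"
  then obtain f where f: "f 0 = A" "f n = B" "\<forall>i\<le>n. is_ideal (f i)" "\<forall>i<n. f i \<subset> f (Suc i)"
    by blast
  have "j \<le> n \<Longrightarrow> ichain (f 0) (f j) j" for j
  proof (induction j)
    case 0
    show ?case by (rule ichain_refl) (use f(3) in blast)
  next
    case (Suc j)
    then have "ichain (f 0) (f j) j" "is_ideal (f (Suc j))" "f j \<subset> f (Suc j)"
      using f(3,4) by auto
    then show ?case by (rule ichain_step)
  qed
  with f(1,2) show "ichain A B n" by blast
qed

text \<open>For ideals \<open>A \<subseteq> B\<close> this is the length of the module
  \<open>B/A\<close>.\<close>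

definition len :: "'a::comm_ring_1 set \<Rightarrow> 'a set \<Rightarrow> enat" where
  "len A B = Sup (enat ` {n. ichain A B n})"

lemma colength_eq_len: "colength A = len A UNIV"
  by (simp add: colength_def len_def ichain_iff)

lemma len_upper: "ichain A B n \<Longrightarrow> enat n \<le> len A B"
  unfolding len_def by (rule Sup_upper) auto

lemma len_least: "(\<And>n. ichain A B n \<Longrightarrow> enat n \<le> l) \<Longrightarrow> len A B \<le> l"
  unfolding len_def by (rule Sup_least) auto

lemma ichain_trans:
  assumes "ichain B C n" "ichain A B k"
  shows "ichain A C (k + n)"
  using assms
proof (induction rule: ichain.induct)
  case (ichain_step B C n D)
  then show ?case using ichain.ichain_step[of A C "k + n" D] by simp
qed simp

lemma ichain_weak:
  assumes "is_ideal A" "is_ideal B" "A \<subseteq> B"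
  shows "\<exists>n. ichain A B n"
proof (cases "A = B")
  case True
  then show ?thesis using ichain_refl assms(1) by blast
next
  case False
  then have "A \<subset> B" using assms(3) by blast
  then show ?thesis using ichain_step[OF ichain_refl[OF assms(1)] assms(2)] by blast
qed

lemma ichain_weak_step:
  assumes "ichain A B n" "is_ideal C" "B \<subseteq> C"
  shows "ichain A C (n + (if B = C then 0 else 1))"
  using assms ichain_step[of A B n C] by auto

text \<open>The modular law: a strict inclusion that disappears on intersecting with
  \<open>B\<close> must survive on adding \<open>B\<close>.\<close>

lemma modular_strict:
  assumes "is_ideal C" "is_ideal D" "is_ideal B" "C \<subset> D" "C \<inter> B = D \<inter> B"
  shows "isum C B \<noteq> isum D B"
proof
  assume eq: "isum C B = isum D B"
  have "D \<subseteq> C"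
  proof
    fix d assume d: "d \<in> D"
    then have "d \<in> isum C B" using isum_upper1[OF assms(3), of D] eq by auto
    then obtain c b where cb: "c \<in> C" "b \<in> B" "d = c + b" by (auto simp: isum_def)
    then have "b \<in> D" using d assms(4) ideal_diff[OF assms(2), of d c] by auto
    then have "b \<in> C" using cb assms(5) by auto
    then show "d \<in> C" using cb ideal_add[OF assms(1)] by auto
  qed
  with assms(4) show False by auto
qed

text \<open>Intersecting with \<open>B\<close> and adding \<open>B\<close> turn a strict chain into
  two weak ones; by \<open>modular_strict\<close> every step stays strict in at least one of
  them.\<close>

lemma ichain_split:
  assumes "ichain A C n" "is_ideal B"
  shows "\<exists>i j. ichain (A \<inter> B) (C \<inter> B) i \<and> ichain (isum A B) (isum C B) j \<and> n \<le> i + j"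
  using assms(1)
proof (induction rule: ichain.induct)
  case (ichain_refl A)
  then show ?case using assms(2) by (auto intro!: exI[of _ 0] ichain.ichain_refl ideal_Int ideal_isum)
next
  case (ichain_step A C n D)
  then obtain i j where ij: "ichain (A \<inter> B) (C \<inter> B) i" "ichain (isum A B) (isum C B) j" "n \<le> i + j"
    by blast
  have "is_ideal C" using ichain_ideals[OF ichain_step(1)] by blast
  then have ne: "C \<inter> B \<noteq> D \<inter> B \<or> isum C B \<noteq> isum D B"
    using modular_strict[of C D B] ichain_step assms(2) by blast
  have "ichain (A \<inter> B) (D \<inter> B) (i + (if C \<inter> B = D \<inter> B then 0 else 1))"
    using ichain_step ij assms(2) by (intro ichain_weak_step ideal_Int) auto
  moreover have "ichain (isum A B) (isum D B) (j + (if isum C B = isum D B then 0 else 1))"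
    using ichain_step ij assms(2) by (intro ichain_weak_step ideal_isum isum_mono) auto
  ultimately show ?case using ij(3) ne by (intro exI conjI) (assumption, assumption, auto)
qed

lemma len_add:
  assumes "is_ideal A" "is_ideal B" "is_ideal C" "A \<subseteq> B" "B \<subseteq> C"
  shows "len A C = len A B + len B C"
proof (rule antisym)
  show "len A C \<le> len A B + len B C"
  proof (rule len_least)
    fix n assume "ichain A C n"
    then obtain i j where ij: "ichain (A \<inter> B) (C \<inter> B) i" "ichain (isum A B) (isum C B) j" "n \<le> i + j"
      using ichain_split assms(2) by blast
    have "A \<inter> B = A" "C \<inter> B = B" using assms by auto
    moreover have "isum A B = B" "isum C B = C"
      using isum_absorb2[OF assms(1,2,4)] isum_absorb1[OF assms(3,2,5)] by auto
    ultimately have ij: "ichain A B i" "ichain B C j" "n \<le> i + j" using ij by auto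
    from ij have "enat i \<le> len A B" "enat j \<le> len B C" by (auto intro: len_upper)
    then have "enat i + enat j \<le> len A B + len B C" by (rule add_mono)
    moreover have "enat n \<le> enat i + enat j" using ij(3) by simp
    ultimately show "enat n \<le> len A B + len B C" by (rule order.trans[rotated])
  qed
next
  obtain k where k: "ichain A B k" using ichain_weak assms by blast
  obtain l where l: "ichain B C l" using ichain_weak assms by blast
  show "len A B + len B C \<le> len A C"
  proof (cases "len A C")
    case infinity
    then show ?thesis by simp
  next
    case (enat M)
    have le: "i + j \<le> M" if "ichain A B i" "ichain B C j" for i j
      using len_upper[OF ichain_trans[OF that(2,1)]] enat by simp
    have "len A B \<le> enat M" by (rule len_least) (use le[OF _ l] in fastforce)
    then obtain a where a: "len A B = enat a" by (cases "len A B") auto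
    have "len B C \<le> enat M" by (rule len_least) (use le[OF k] in fastforce)
    then obtain b where b: "len B C = enat b" by (cases "len B C") auto
    \<comment> \<open>For a fixed upper chain the supremum over the lower chains is at most
      \<open>M - j\<close>. The bound \<open>j \<le> M\<close> is recorded as well because
      subtraction of naturals truncates.\<close>
    have "a \<le> M - j \<and> j \<le> M" if j: "ichain B C j" for j
    proof -
      have "len A B \<le> enat (M - j)"
      proof (rule len_least)
        fix i assume "ichain A B i"
        then show "enat i \<le> enat (M - j)" using le[OF _ j, of i] by simp
      qed
      then show ?thesis using a le[OF k j] by simp
    qed
    then have "len B C \<le> enat (M - a)"
      by (intro len_least) fastforce
    moreover have "a \<le> M" using \<open>len A B \<le> enat M\<close> a by simp
    ultimately have "a + b \<le> M" using b by simp
    then show ?thesis using a b enat by (simp add: add.commute)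
  qed
qed

lemma len_self: "is_ideal A \<Longrightarrow> len A A = 0"
proof -
  assume A: "is_ideal A"
  have "n = 0" if "ichain A A n" for n
    using that
  proof (cases rule: ichain.cases)
    case (ichain_step B k)
    then show ?thesis using ichain_ideals[of A B k] by blast
  qed
  then have "len A A \<le> 0" by (intro len_least) (auto simp: zero_enat_def)
  then show ?thesis by simp
qed

lemma len_pos: "is_ideal A \<Longrightarrow> is_ideal B \<Longrightarrow> A \<subset> B \<Longrightarrow> 1 \<le> len A B"
  using len_upper[OF ichain_step[OF ichain_refl]] by (simp add: one_enat_def)

lemma len_mono:
  assumes "is_ideal A" "is_ideal B" "is_ideal C" "A \<subseteq> B" "B \<subseteq> C"
  shows "len A B \<le> len A C" "len B C \<le> len A C"
  using len_add[OF assms] by auto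

text \<open>Strictly monotone maps between intervals of ideals carry chains to chains; two such maps
  replace an isomorphism of quotient modules.\<close>

lemma ichain_image:
  assumes "ichain A B n"
    and ideal: "\<And>E. is_ideal E \<Longrightarrow> A \<subseteq> E \<Longrightarrow> E \<subseteq> B \<Longrightarrow> is_ideal (f E)"
    and strict: "\<And>E E'. is_ideal E \<Longrightarrow> is_ideal E' \<Longrightarrow> A \<subseteq> E \<Longrightarrow> E \<subset> E' \<Longrightarrow> E' \<subseteq> B \<Longrightarrow> f E \<subset> f E'"
  shows "ichain (f A) (f B) n"
  using assms
proof (induction rule: ichain.induct)
  case (ichain_refl A)
  show ?case by (intro ichain.ichain_refl ichain_refl(2)) (use ichain_refl(1) in simp_all)
next
  case (ichain_step A B n C)
  have B: "is_ideal B" "A \<subseteq> B" using ichain_ideals[OF ichain_step(1)] by auto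
  have BC: "E \<subseteq> B \<Longrightarrow> E \<subseteq> C" for E using ichain_step(3) by blast
  show ?case
  proof (rule ichain.ichain_step)
    show "ichain (f A) (f B) n"
      by (rule ichain_step.IH; (rule ichain_step.prems; assumption | rule ichain_step.prems, assumption+, erule BC))
    show "is_ideal (f C)" using B ichain_step.hyps by (intro ichain_step.prems(1)) auto
    show "f B \<subset> f C" using B ichain_step.hyps by (intro ichain_step.prems(2)) auto
  qed
qed

text \<open>Multiplication by \<open>b\<close> induces an isomorphism from \<open>C / (C \<inter> (D : b))\<close> onto \<open>(D + bC) / D\<close>.\<close>

lemma len_mult:
  assumes C: "is_ideal C" and D: "is_ideal D"
  shows "len D (isum D (smult_set b C)) = len (C \<inter> {z. b * z \<in> D}) C"
proof (rule antisym)
  have DC: "is_ideal (isum D (smult_set b C))" by (intro ideal_isum ideal_smult_set C D)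
  \<comment> \<open>Each inequality transports chains: this one by preimages under multiplication by
    \<open>b\<close>, the other one by images.\<close>
  let ?f = "\<lambda>E. C \<inter> {z. b * z \<in> E}"
  have top: "?f (isum D (smult_set b C)) = C"
    using isum_upper2[OF D, of "smult_set b C"] by (auto simp: smult_set_def)
  show "len D (isum D (smult_set b C)) \<le> len (?f D) C"
  proof (rule len_least)
    fix n assume n: "ichain D (isum D (smult_set b C)) n"
    have "ichain (?f D) (?f (isum D (smult_set b C))) n"
    proof (rule ichain_image[OF n])
      fix E E' :: "'a set" assume E: "is_ideal E" "is_ideal E'" "D \<subseteq> E" "E \<subset> E'" "E' \<subseteq> isum D (smult_set b C)"
      then obtain e where e: "e \<in> E'" "e \<notin> E" by blast
      then obtain d c where dc: "d \<in> D" "c \<in> C" "e = d + b * c"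
        using E by (fastforce simp: isum_def smult_set_def)
      then have "b * c \<in> E'" using e E ideal_diff[OF E(2), of e d] by auto
      moreover have "b * c \<notin> E" using e E dc ideal_add[OF E(1), of d "b * c"] by auto
      ultimately show "?f E \<subset> ?f E'" using dc E by auto
    qed (intro ideal_Int C ideal_preimage_mult)
    then show "enat n \<le> len (?f D) C" unfolding top by (rule len_upper)
  qed
  let ?g = "\<lambda>E. isum D (smult_set b E)"
  have bot: "?g (?f D) = D"
    by (rule isum_absorb1[OF D ideal_smult_set[OF ideal_Int[OF C ideal_preimage_mult[OF D]]]])
      (auto simp: smult_set_def)
  show "len (?f D) C \<le> len D (?g C)"
  proof (rule len_least)
    fix n assume n: "ichain (?f D) C n"
    have "ichain (?g (?f D)) (?g C) n"
    proof (rule ichain_image[OF n])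
      fix E E' :: "'a set" assume E: "is_ideal E" "is_ideal E'" "?f D \<subseteq> E" "E \<subset> E'" "E' \<subseteq> C"
      then obtain c where c: "c \<in> E'" "c \<notin> E" by blast
      have "b * c \<notin> ?g E"
      proof
        assume "b * c \<in> ?g E"
        then obtain d c' where "d \<in> D" "c' \<in> E" "b * c = d + b * c'"
          by (auto simp: isum_def smult_set_def)
        then have "b * (c - c') \<in> D" "c' \<in> E" "c' \<in> C" by (auto simp: right_diff_distrib) (use E in auto)
        moreover have "c - c' \<in> C" using c E \<open>c' \<in> C\<close> ideal_diff[OF C] by auto
        ultimately have "c - c' \<in> E" using E by auto
        then have "c \<in> E" using ideal_add[OF E(1), of "c - c'" c'] \<open>c' \<in> E\<close> by simp
        with c show False by simp
      qed
      moreover have "b * c \<in> ?g E'" using c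
        by (intro subsetD[OF isum_upper2[OF D]]) (auto simp: smult_set_def)
      moreover have "?g E \<subseteq> ?g E'" using E by (intro isum_mono) (auto simp: smult_set_def)
      ultimately show "?g E \<subset> ?g E'" by blast
    qed (intro ideal_isum D ideal_smult_set)
    then show "enat n \<le> len D (?g C)" unfolding bot by (rule len_upper)
  qed
qed

text \<open>Each further generator adds a cyclic module annihilated by \<open>A\<close>, hence of
  length at most that of \<open>R/A\<close>.\<close>

lemma len_gen_le:
  assumes D: "is_ideal D" and A: "is_ideal A" and "finite G"
    and AG: "\<And>z g. z \<in> A \<Longrightarrow> g \<in> G \<Longrightarrow> z * g \<in> D"
  shows "len D (isum D (ideal_gen G)) \<le> of_nat (card G) * len A UNIV"
  using assms(3,4)
proof (induction G)
  case empty
  then show ?case using D by (simp add: ideal_gen_empty isum_absorb1 ideal_zero_set ideal_zero len_self)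
next
  case (insert g G)
  let ?E = "isum D (ideal_gen G)"
  have E: "is_ideal ?E" by (intro ideal_isum D ideal_gen_ideal)
  have eq: "isum D (ideal_gen (insert g G)) = isum ?E (smult_set g UNIV)"
    by (simp add: ideal_gen_insert isum_assoc isum_commute[of "smult_set g UNIV"])
  have DE: "D \<subseteq> ?E" by (rule isum_upper1[OF ideal_gen_ideal])
  have i: "is_ideal (isum ?E (smult_set g UNIV))" by (intro ideal_isum E ideal_smult_set ideal_UNIV)
  have "len ?E (isum ?E (smult_set g UNIV)) = len {z. g * z \<in> ?E} UNIV"
    using len_mult[OF ideal_UNIV E, of g] by simp
  also have "\<dots> \<le> len A UNIV"
    using insert(4) DE by (intro len_mono A ideal_preimage_mult E ideal_UNIV) (auto simp: mult.commute)
  finally have 1: "len ?E (isum ?E (smult_set g UNIV)) \<le> len A UNIV" .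
  have "len D (isum ?E (smult_set g UNIV)) = len D ?E + len ?E (isum ?E (smult_set g UNIV))"
    by (intro len_add D E i DE isum_upper1 ideal_smult_set ideal_UNIV)
  also have "\<dots> \<le> of_nat (card G) * len A UNIV + len A UNIV"
    using 1 insert by (intro add_mono) auto
  also have "\<dots> = of_nat (card (insert g G)) * len A UNIV"
    using insert(1,2) by (simp add: distrib_right add.commute)
  finally show ?case unfolding eq .
qed

lemma len_maximal: "maximal_ideal m \<Longrightarrow> len m UNIV \<le> 1"
proof (rule len_least)
  fix n assume m: "maximal_ideal m" and n: "ichain m UNIV n"
  from n have "n \<le> 1"
  proof (cases rule: ichain.cases)
    case (ichain_step B k)
    then have "B = m" using ichain_ideals[of m B k] m unfolding maximal_ideal_def by blast
    with ichain_step(2) have "k = 0" by (cases rule: ichain.cases) (auto dest: ichain_ideals)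
    then show ?thesis using ichain_step by simp
  qed auto
  then show "enat n \<le> 1" by (simp add: one_enat_def)
qed

section \<open>Primes, Nakayama's lemma and regular sequences\<close>

text \<open>By Zorn's lemma there is an ideal maximal among those containing \<open>I\<close> and
  disjoint from \<open>S\<close>, and such an ideal is prime. Maximality is part of the conclusion
  so that \<open>S = {1}\<close> yields maximal ideals.\<close>

lemma prime_avoiding:
  fixes I S :: "'a::comm_ring_1 set"
  assumes I: "is_ideal I" and S: "1 \<in> S" "\<And>a b. a \<in> S \<Longrightarrow> b \<in> S \<Longrightarrow> a * b \<in> S"
    and disj: "I \<inter> S = {}"
  obtains P where "prime_ideal P" "I \<subseteq> P" "P \<inter> S = {}"
    "\<And>J. is_ideal J \<Longrightarrow> P \<subseteq> J \<Longrightarrow> J \<inter> S = {} \<Longrightarrow> J = P"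
proof -
  let ?A = "{J. is_ideal J \<and> I \<subseteq> J \<and> J \<inter> S = {}}"
  have "\<exists>M\<in>?A. \<forall>X\<in>?A. M \<subseteq> X \<longrightarrow> X = M"
  proof (rule subset_Zorn_nonempty)
    show "?A \<noteq> {}" using I disj by blast
    fix C assume C: "C \<noteq> {}" "subset.chain ?A C"
    have cl: "is_ideal K" "I \<subseteq> K" "K \<inter> S = {}" if "K \<in> C" for K
      using C(2) that unfolding subset.chain_def by auto
    have tot: "K \<subseteq> L \<or> L \<subseteq> K" if "K \<in> C" "L \<in> C" for K L
      using C(2) that unfolding subset_chain_def by blast
    have "is_ideal (\<Union>C)"
      unfolding is_ideal_def
    proof (intro conjI ballI allI)
      show "0 \<in> \<Union>C" using C(1) cl(1) ideal_zero by blast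
    next
      fix x y assume "x \<in> \<Union>C" "y \<in> \<Union>C"
      then obtain K L where "K \<in> C" "L \<in> C" "x \<in> K" "y \<in> L" by blast
      then show "x + y \<in> \<Union>C" using tot[of K L] cl(1) ideal_add by blast
    next
      fix r x assume "x \<in> \<Union>C"
      then show "r * x \<in> \<Union>C" using cl(1) ideal_mult_left by blast
    qed
    then show "\<Union>C \<in> ?A" using C(1) cl by blast
  qed
  then obtain P where P: "is_ideal P" "I \<subseteq> P" "P \<inter> S = {}"
    and maxi: "\<And>J. is_ideal J \<Longrightarrow> P \<subseteq> J \<Longrightarrow> J \<inter> S = {} \<Longrightarrow> J = P"
    by (auto 0 4)
  have meets: "\<exists>r. \<exists>c\<in>P. c + a * r \<in> S" if "a \<notin> P" for a
  proof (rule ccontr)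
    assume no: "\<not> ?thesis"
    let ?J = "isum P (smult_set a UNIV)"
    have i: "is_ideal ?J" by (intro ideal_isum P ideal_smult_set ideal_UNIV)
    have "?J \<inter> S = {}" using no by (auto simp: isum_def smult_set_def)
    moreover have "P \<subseteq> ?J" by (intro isum_upper1 ideal_smult_set ideal_UNIV)
    ultimately have "?J = P" using maxi[OF i] by blast
    moreover have "a * 1 \<in> ?J"
      by (intro subsetD[OF isum_upper2[OF P(1)]]) (unfold smult_set_def, blast)
    ultimately show False using that by simp
  qed
  have "prime_ideal P"
    unfolding prime_ideal_def
  proof (intro conjI allI impI P)
    show "P \<noteq> UNIV" using P(3) S(1) by auto
    fix a b assume ab: "a * b \<in> P"
    show "a \<in> P \<or> b \<in> P"
    proof (rule ccontr)
      assume "\<not> ?thesis"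
      then obtain r c r' c' where *: "c \<in> P" "c' \<in> P" "c + a * r \<in> S" "c' + b * r' \<in> S"
        using meets by blast
      have "(c + a * r) * (c' + b * r') = c * (c' + b * r') + a * r * c' + (a * b) * (r * r')"
        by (simp add: algebra_simps)
      also have "\<dots> \<in> P"
        by (intro ideal_add[OF P(1)] ideal_mult_right[OF P(1) *(1)] ideal_mult_left[OF P(1) *(2)]
            ideal_mult_right[OF P(1) ab])
      finally show False using S(2)[OF *(3,4)] P(3) by blast
    qed
  qed
  then show thesis using P(2,3) maxi that by blast
qed

text \<open>A non-unit generates an ideal without \<open>1\<close>, which lies in a maximal ideal;
  by locality that ideal is \<open>m\<close>.\<close>

lemma local_unit:
  fixes m :: "'a::comm_ring_1 set"
  assumes "local_ring TYPE('a)" "maximal_ideal m" "u \<notin> m"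
  shows "\<exists>v. u * v = 1"
proof (rule ccontr)
  assume no: "\<not> ?thesis"
  have "smult_set u UNIV \<inter> {1} = {}" using no by (auto simp: smult_set_def)
  then obtain P where P: "prime_ideal P" "smult_set u UNIV \<subseteq> P" "P \<inter> {1} = {}"
    "\<And>J. is_ideal J \<Longrightarrow> P \<subseteq> J \<Longrightarrow> J \<inter> {1} = {} \<Longrightarrow> J = P"
    using prime_avoiding[OF ideal_smult_set[OF ideal_UNIV], of "{1}" u] by auto
  have "maximal_ideal P"
    unfolding maximal_ideal_def using P ideal_eq_UNIV by (auto simp: prime_ideal_def)
  then have "P = m" using assms(1,2) unfolding local_ring_def by blast
  moreover have "u * 1 \<in> P" using P(2) by (rule subsetD) (unfold smult_set_def, blast)
  ultimately show False using assms(3) by simp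
qed

lemma krull_dim_2_no_chain:
  assumes "krull_dim TYPE('a::comm_ring_1) = 2"
    "prime_ideal (P0::'a set)" "prime_ideal P1" "prime_ideal P2" "prime_ideal P3"
    "P0 \<subset> P1" "P1 \<subset> P2" "P2 \<subset> P3"
  shows False
proof -
  let ?f = "\<lambda>i::nat. if i = 0 then P0 else if i = 1 then P1 else if i = 2 then P2 else P3"
  have "\<exists>f :: nat \<Rightarrow> 'a set. (\<forall>i\<le>3. prime_ideal (f i)) \<and> (\<forall>i<3. f i \<subset> f (Suc i))"
    using assms(2-) by (intro exI[of _ ?f]) (auto simp: numeral_eq_Suc less_Suc_eq)
  then have "enat 3 \<le> krull_dim TYPE('a)" unfolding krull_dim_def by (intro Sup_upper) blast
  then show False using assms(1) by (simp add: numeral_eq_enat)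
qed

lemma maximal_ideal_prime:
  assumes m: "maximal_ideal m"
  shows "prime_ideal m"
proof -
  have i: "is_ideal m" "m \<inter> {1} = {}" using m ideal_eq_UNIV by (auto simp: maximal_ideal_def)
  obtain P where P: "prime_ideal P" "m \<subseteq> P"
    by (rule prime_avoiding[OF i(1), of "{1}"]) (use i(2) in auto)
  then show "prime_ideal m" using m unfolding maximal_ideal_def prime_ideal_def by blast
qed

text \<open>The regular sequence \<open>(p, q)\<close> in terms of elements: \<open>p\<close> is a
  nonzerodivisor, and \<open>q\<close> is one modulo \<open>p\<close>.\<close>

locale regular_pair =
  fixes p q :: "'a::comm_ring_1"
  assumes p_reg: "r * p = 0 \<Longrightarrow> r = 0"
    and q_reg: "r * q = p * s \<Longrightarrow> \<exists>s'. r = p * s'"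
begin

lemma p_power_reg: "r * p ^ k = 0 \<Longrightarrow> r = 0"
proof (induction k arbitrary: r)
  case (Suc k)
  then have "(r * p) * p ^ k = 0" by (simp add: mult.assoc)
  then show ?case using Suc(1) p_reg by blast
qed simp

text \<open>Regularity of \<open>q\<close> passes from \<open>R/(p)\<close> to
  \<open>R/(p^k)\<close> by dividing out one factor \<open>p\<close> at a time.\<close>

lemma q_reg_p_power: "r * q = p ^ k * s \<Longrightarrow> \<exists>s'. r = p ^ k * s'"
proof (induction k arbitrary: r s)
  case 0
  show ?case by simp
next
  case (Suc k)
  then have "r * q = p * (p ^ k * s)" by (simp add: mult.assoc)
  then obtain r' where r': "r = p * r'" using q_reg by blast
  with Suc(2) have "(r' * q - p ^ k * s) * p = 0" by (simp add: algebra_simps)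
  then have "r' * q = p ^ k * s" using p_reg by fastforce
  then obtain s' where "r' = p ^ k * s'" using Suc(1) by blast
  with r' have "r = p ^ Suc k * s'" by (simp add: mult.assoc)
  then show ?case by blast
qed

lemma q_power_reg: "r * q ^ l = p ^ k * s \<Longrightarrow> \<exists>s'. r = p ^ k * s'"
proof (induction l arbitrary: r s)
  case 0
  then show ?case by auto
next
  case (Suc l)
  then have "(r * q) * q ^ l = p ^ k * s" by (simp add: mult.assoc)
  then obtain s' where "r * q = p ^ k * s'" using Suc(1) by blast
  then show ?case by (rule q_reg_p_power)
qed

text \<open>Here \<open>u q^l = p^k v\<close>, so \<open>p^k\<close> divides \<open>u\<close>;
  cancelling it from \<open>p^k = g u\<close> makes \<open>g\<close> a unit. This is why no
  principal ideal inside \<open>m\<close> contains powers of both \<open>p\<close> and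
  \<open>q\<close>.\<close>

lemma powers_not_multiples:
  assumes "p ^ k = g * u" "q ^ l = g * v"
  shows "\<exists>w. g * w = 1"
proof -
  have "u * q ^ l = p ^ k * v" using assms by (simp add: algebra_simps)
  then obtain w where "u = p ^ k * w" using q_power_reg by blast
  with assms(1) have "(1 - g * w) * p ^ k = 0" by (simp add: algebra_simps)
  then have "1 - g * w = 0" by (rule p_power_reg)
  then show ?thesis by (intro exI[of _ w]) simp
qed

text \<open>The first Koszul homology of \<open>(a, b)\<close> is killed by \<open>p ^ k\<close> and by \<open>q ^ l\<close>; comparing the
  two resulting boundaries shows that it vanishes.\<close>

lemma koszul_exact:
  assumes "p ^ k \<in> ideal_gen {a, b}" "q ^ l \<in> ideal_gen {a, b}" and rs: "r * a + s * b = 0"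
  shows "\<exists>t. r = t * b \<and> s = - (t * a)"
proof -
  obtain u v where P: "p ^ k = a * u + b * v" using assms(1) by (auto simp: ideal_gen_pair_mem)
  obtain u' v' where Q: "q ^ l = a * u' + b * v'" using assms(2) by (auto simp: ideal_gen_pair_mem)
  have ra: "r * a = - (s * b)" using rs by (simp add: eq_neg_iff_add_eq_0)
  \<comment> \<open>The element \<open>a u + b v\<close> annihilates Koszul homology: multiplying
    the cycle \<open>(r, s)\<close> by it gives a boundary with coefficient
    \<open>v r - u s\<close>.\<close>
  have boundary: "r * (a * u + b * v) = b * (v * r - u * s) \<and> s * (a * u + b * v) = - (a * (v * r - u * s))"
    for u v
  proof
    have "r * (a * u + b * v) = (r * a) * u + b * v * r" by (simp add: algebra_simps)
    then show "r * (a * u + b * v) = b * (v * r - u * s)" unfolding ra by (simp add: algebra_simps)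
    have "s * (a * u + b * v) = s * a * u - v * - (s * b)" by (simp add: algebra_simps)
    then show "s * (a * u + b * v) = - (a * (v * r - u * s))" unfolding ra[symmetric] by (simp add: algebra_simps)
  qed
  define t where "t = v * r - u * s"
  define t' where "t' = v' * r - u' * s"
  have t: "r * p ^ k = b * t" "s * p ^ k = - (a * t)" using boundary P t_def by auto
  have t': "r * q ^ l = b * t'" "s * q ^ l = - (a * t')" using boundary Q t'_def by auto
  \<comment> \<open>The difference of the two boundary coefficients after cross-multiplication. It
    is killed by \<open>a\<close> and \<open>b\<close>, hence by \<open>p^k\<close>, hence zero;
    then \<open>p^k\<close> divides \<open>t\<close>, and the quotient is the witness.\<close>
  define z where "z = t * q ^ l - t' * p ^ k"
  have "b * z = (b * t) * q ^ l - (b * t') * p ^ k" unfolding z_def by (simp add: algebra_simps)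
  also have "\<dots> = 0" unfolding t(1)[symmetric] t'(1)[symmetric] by (simp add: algebra_simps)
  finally have b0: "b * z = 0" .
  have "a * z = - (- (a * t)) * q ^ l + (- (a * t')) * p ^ k" unfolding z_def by (simp add: algebra_simps)
  also have "\<dots> = 0" unfolding t(2)[symmetric] t'(2)[symmetric] by (simp add: algebra_simps)
  finally have a0: "a * z = 0" .
  have "z * p ^ k = (a * z) * u + (b * z) * v" unfolding P by (simp add: algebra_simps)
  then have "z * p ^ k = 0" by (simp add: a0 b0)
  then have "z = 0" by (rule p_power_reg)
  then have "t * q ^ l - t' * p ^ k = 0" unfolding z_def .
  then have "t * q ^ l = p ^ k * t'" by (metis eq_iff_diff_eq_0 mult.commute)
  then obtain w where w: "t = p ^ k * w" using q_power_reg by blast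
  have "(r - w * b) * p ^ k = 0" "(s + w * a) * p ^ k = 0"
    using t w by (simp_all add: algebra_simps)
  then have "r = w * b" "s = - (w * a)" using p_power_reg by (fastforce simp: eq_neg_iff_add_eq_0)+
  then show ?thesis by blast
qed

text \<open>In dimension two a regular pair generates an ideal primary to the maximal one: otherwise a
  prime \<open>P \<noteq> m\<close> containing \<open>p\<close> and \<open>q\<close> would sit on top of a chain \<open>P0 \<subset> P1 \<subset> P\<close>, with
  \<open>P1\<close> disjoint from \<open>{s q\<^sup>i | s \<notin> P}\<close> and \<open>P0\<close> disjoint from \<open>{s p\<^sup>i | s \<notin> P1}\<close>.\<close>

lemma prime_containing_pair:
  assumes dim: "krull_dim TYPE('a) = 2" and m: "maximal_ideal m"
    and P: "prime_ideal P" "P \<subseteq> m" "p \<in> P" "q \<in> P"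
  shows "P = m"
proof -
  have closed: "\<exists>s'. s' \<notin> A \<and> (\<exists>k. (s * c ^ i) * (t * c ^ j) = s' * c ^ k)"
    if "prime_ideal A" "s \<notin> A" "t \<notin> A" for A and s t c :: 'a and i j
  proof (intro exI conjI)
    show "s * t \<notin> A" using that by (auto simp: prime_ideal_def)
    show "(s * c ^ i) * (t * c ^ j) = (s * t) * c ^ (i + j)" by (simp add: power_add algebra_simps)
  qed
  have one: "1 \<notin> A" if "prime_ideal A" for A :: "'a set"
    using that ideal_eq_UNIV by (auto simp: prime_ideal_def)
  let ?S1 = "{s * q ^ i | s i. s \<notin> P}"
  \<comment> \<open>If \<open>s q^i\<close> is a multiple of \<open>p\<close>, then so is
    \<open>s\<close> by regularity, which puts \<open>s\<close> into \<open>P\<close>.\<close>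
  have "smult_set p UNIV \<inter> ?S1 = {}"
  proof (rule ccontr)
    assume "\<not> ?thesis"
    then obtain z where "z \<in> smult_set p UNIV" "z \<in> ?S1" by blast
    then obtain r s i where "z = p * r" "z = s * q ^ i" and s: "s \<notin> P"
      unfolding smult_set_UNIV_mem by blast
    then have "s * q ^ i = p * r" by simp
    then obtain s' where "s = p * s'" using q_power_reg[of s i 1 r] by auto
    then show False using s P ideal_mult_right[of P p s'] by (auto simp: prime_ideal_def)
  qed
  then obtain P1 where P1: "prime_ideal P1" "smult_set p UNIV \<subseteq> P1" "P1 \<inter> ?S1 = {}"
  proof (rule prime_avoiding[OF ideal_smult_set[OF ideal_UNIV], rotated 2])
    show "1 \<in> ?S1" using one[OF P(1)] by (auto intro!: exI[of _ 1] exI[of _ "0::nat"])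
    show "a * b \<in> ?S1" if "a \<in> ?S1" "b \<in> ?S1" for a b
      using that closed[OF P(1)] by fastforce
  qed
  have "s * q ^ 0 \<in> ?S1" if "s \<notin> P" for s using that by blast
  then have P1P: "P1 \<subseteq> P" using P1(3) by (auto simp: disjoint_iff)
  have "1 * q ^ 1 \<in> ?S1" using one[OF P(1)] by blast
  then have "q \<notin> P1" using P1(3) by auto
  with P1P P(4) have s1: "P1 \<subset> P" by auto
  let ?S0 = "{s * p ^ i | s i. s \<notin> P1}"
  have "{0} \<inter> ?S0 = {}"
    using p_power_reg ideal_zero P1(1) by (fastforce simp: prime_ideal_def)
  then obtain P0 where P0: "prime_ideal P0" "P0 \<inter> ?S0 = {}"
  proof (rule prime_avoiding[OF ideal_zero_set, rotated 2])
    show "1 \<in> ?S0" using one[OF P1(1)] by (auto intro!: exI[of _ 1] exI[of _ "0::nat"])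
    show "a * b \<in> ?S0" if "a \<in> ?S0" "b \<in> ?S0" for a b
      using that closed[OF P1(1)] by fastforce
  qed
  have "s * p ^ 0 \<in> ?S0" if "s \<notin> P1" for s using that by blast
  then have P0P: "P0 \<subseteq> P1" using P0(2) by (auto simp: disjoint_iff)
  have "1 * p ^ 1 \<in> ?S0" using one[OF P1(1)] by blast
  then have "p \<notin> P0" using P0(2) by auto
  moreover have "p * 1 \<in> P1" using P1(2) by (rule subsetD) (unfold smult_set_def, blast)
  ultimately have s0: "P0 \<subset> P1" using P0P by auto
  show ?thesis
    using krull_dim_2_no_chain[OF dim P0(1) P1(1) P(1) maximal_ideal_prime[OF m] s0 s1] P(2) by blast
qed

end

text \<open>Locality enters as invertibility of the elements outside \<open>m\<close>.\<close>

locale noetherian_local =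
  fixes m :: "'a::comm_ring_1 set"
  assumes max: "maximal_ideal m"
    and unit: "u \<notin> m \<Longrightarrow> \<exists>v. u * v = 1"
    and noeth: "is_ideal (I :: 'a set) \<Longrightarrow> \<exists>F. finite F \<and> I = ideal_gen F"
begin

lemma m_ideal: "is_ideal m" and m_one: "1 \<notin> m" and m_prime: "prime_ideal m"
  using max ideal_eq_UNIV maximal_ideal_prime by (auto simp: maximal_ideal_def)

lemma ideal_subset_m: "is_ideal I \<Longrightarrow> I \<noteq> UNIV \<Longrightarrow> I \<subseteq> m"
proof
  fix x assume I: "is_ideal I" "I \<noteq> UNIV" "x \<in> I"
  show "x \<in> m"
  proof (rule ccontr)
    assume "x \<notin> m"
    then obtain v where "x * v = 1" using unit by blast
    then have "1 \<in> I" using ideal_mult_right[OF I(1,3), of v] by simp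
    then show False using ideal_eq_UNIV I by blast
  qed
qed

lemma unit_cancel:
  assumes "is_ideal I" "u \<notin> m" "u * z \<in> I"
  shows "z \<in> I"
proof -
  obtain v where "u * v = 1" using unit assms by blast
  then have "v * (u * z) = z" by (simp add: mult.assoc[symmetric] mult.commute)
  then show ?thesis using ideal_mult_left[OF assms(1,3), of v] by simp
qed

text \<open>Induction on the generators: the hypothesis for \<open>g\<close> reads
  \<open>(1 - c) g\<close> in \<open>D + (F)\<close> with \<open>c\<close> in \<open>m\<close>, and
  \<open>1 - c\<close> is a unit, so \<open>g\<close> can be eliminated.\<close>

lemma nakayama_finite:
  assumes "finite F" "is_ideal D" "F \<subseteq> isum D (iprod m (ideal_gen F))"
  shows "F \<subseteq> D"
  using assms
proof (induction F)
  case empty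
  then show ?case by simp
next
  case (insert g F)
  let ?M = "ideal_gen F"
  let ?D' = "isum D ?M"
  have D': "is_ideal ?D'" by (intro ideal_isum insert ideal_gen_ideal)
  have mM: "iprod m ?M \<subseteq> ?M" by (rule iprod_subset_right[OF ideal_gen_ideal])
  have mg: "iprod m (ideal_gen (insert g F)) \<subseteq> isum (smult_set g m) (iprod m ?M)"
  proof -
    have "iprod m (ideal_gen (insert g F)) \<subseteq> isum (iprod (smult_set g UNIV) m) (iprod ?M m)"
      unfolding ideal_gen_insert
      by (subst iprod_commute, intro isum_iprod_subset ideal_smult_set ideal_UNIV ideal_gen_ideal)
    also have "\<dots> \<subseteq> isum (smult_set g m) (iprod m ?M)"
      by (intro isum_mono smult_set_iprod_subset m_ideal) (simp add: iprod_commute)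
    finally show ?thesis .
  qed
  have "g \<in> isum D (isum (smult_set g m) (iprod m ?M))"
    using insert(5) isum_mono[OF order.refl mg] by blast
  then obtain d c k where dck: "d \<in> D" "c \<in> m" "k \<in> iprod m ?M" "g = d + (g * c + k)"
    by (auto simp: isum_def smult_set_def)
  have "(1 - c) * g = d + k" using dck(4) by (simp add: algebra_simps)
  also have "d + k \<in> ?D'" using dck mM by (intro isumI) auto
  finally have "(1 - c) * g \<in> ?D'" .
  moreover have "1 - c \<notin> m" using ideal_add[OF m_ideal, of "1 - c" c] dck(2) m_one by auto
  ultimately have g: "g \<in> ?D'" using unit_cancel[OF D'] by blast
  \<comment> \<open>Since \<open>g\<close> lies in \<open>D + (F)\<close>, the term
    \<open>m (g, F)\<close> is absorbed by \<open>D + m (F)\<close>, and the induction hypothesis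
    applies to \<open>F\<close>.\<close>
  have "F \<subseteq> isum D (iprod m ?M)"
  proof -
    have "?M \<subseteq> ?D'" by (rule isum_upper2[OF insert(4)])
    then have "ideal_gen (insert g F) \<subseteq> ?D'"
      using g ideal_gen_superset[of F] by (intro ideal_gen_least D') auto
    then have "iprod m (ideal_gen (insert g F)) \<subseteq> iprod ?D' m"
      by (subst iprod_commute) (intro iprod_mono order.refl)
    also have "\<dots> \<subseteq> isum (iprod D m) (iprod ?M m)"
      by (intro isum_iprod_subset insert ideal_gen_ideal)
    also have "\<dots> \<subseteq> isum D (iprod m ?M)"
      by (intro isum_mono iprod_subset_left insert) (simp add: iprod_commute)
    finally have "isum D (iprod m (ideal_gen (insert g F))) \<subseteq> isum D (iprod m ?M)"
      using isum_upper1[OF ideal_iprod, of D m ?M]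
      by (intro isum_least ideal_isum insert ideal_iprod)
    then show ?thesis using insert(5) by blast
  qed
  then have F: "F \<subseteq> D" using insert by blast
  then have "?D' = D" using ideal_gen_least[OF insert.prems(1)] isum_absorb1[OF insert.prems(1) ideal_gen_ideal] by blast
  then show ?case using g F by auto
qed

lemma nakayama:
  assumes "is_ideal M" "is_ideal D" "M \<subseteq> isum D (iprod m M)"
  shows "M \<subseteq> D"
proof -
  obtain F where F: "finite F" "M = ideal_gen F" using noeth assms by blast
  have "F \<subseteq> M" using F(2) ideal_gen_superset by blast
  then have "F \<subseteq> D" using nakayama_finite[OF F(1) assms(2)] assms(3) F(2) by blast
  then show ?thesis using F(2) ideal_gen_least assms(2) by blast
qed

end

text \<open>What is retained of a two-dimensional Cohen-Macaulay local ring with infinite residue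
  field: a regular sequence \<open>(p, q)\<close> in \<open>m\<close> generating an ideal whose
  radical contains \<open>m\<close>.\<close>

locale cm2_local = noetherian_local m + regular_pair p q for m :: "'a::comm_ring_1 set" and p q +
  assumes pm: "p \<in> m" and qm: "q \<in> m"
    and primary: "y \<in> m \<Longrightarrow> \<exists>k. y ^ k \<in> ideal_gen {p, q}"
    and inf_res: "infinite_residue_field m"

text \<open>Depth two provides a regular sequence in \<open>m\<close> with at least two entries; the
  first two are \<open>p\<close> and \<open>q\<close>. If no power of some \<open>y\<close> in
  \<open>m\<close> lay in \<open>(p, q)\<close>, a prime containing \<open>(p, q)\<close> and
  avoiding these powers would equal \<open>m\<close> by \<open>prime_containing_pair\<close>,
  although it misses \<open>y\<close>.\<close>

lemma cm2_local_exists: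
  fixes m :: "'a::comm_ring_1 set"
  assumes cm: "cohen_macaulay_local m" and dim: "krull_dim TYPE('a) = 2"
    and inf: "infinite_residue_field m"
  shows "\<exists>p q. cm2_local m p q"
proof -
  have m: "maximal_ideal m" "local_ring TYPE('a)" "noetherian_ring TYPE('a)" "depth m = 2"
    using cm dim by (auto simp: cohen_macaulay_local_def)
  interpret noetherian_local m
    using m local_unit by unfold_locales (auto simp: noetherian_ring_def)
  have "\<exists>xs. set xs \<subseteq> m \<and> regular_seq xs \<and> 2 \<le> length xs"
  proof (rule ccontr)
    assume no: "\<not> ?thesis"
    have "depth m \<le> 1"
      unfolding depth_def
    proof (rule Sup_least)
      fix z assume "z \<in> enat ` {length xs |xs. set xs \<subseteq> m \<and> regular_seq xs}"
      then obtain xs where "z = enat (length xs)" "set xs \<subseteq> m" "regular_seq xs" by auto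
      then show "z \<le> 1" using no by (auto simp: one_enat_def not_le dest!: spec[of _ xs])
    qed
    then show False using m(4) by simp
  qed
  then obtain xs where xs: "set xs \<subseteq> m" "regular_seq xs" "2 \<le> length xs" by blast
  define p where "p = xs ! 0"
  define q where "q = xs ! 1"
  have reg: "r * xs ! i \<in> ideal_gen (set (take i xs)) \<Longrightarrow> r \<in> ideal_gen (set (take i xs))"
    if "i < length xs" for i r using xs(2) that unfolding regular_seq_def by blast
  have "take 1 xs = [p]" using xs(3) by (cases xs) (auto simp: p_def)
  then have take1: "set (take 1 xs) = {p}" by simp
  interpret regular_pair p q
  proof
    show "r = 0" if "r * p = 0" for r
      using reg[of 0 r] xs(3) that by (cases xs) (auto simp: p_def ideal_gen_empty)
    show "\<exists>s'. r = p * s'" if "r * q = p * s" for r s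
      using reg[of 1 r] xs(3) that unfolding take1 ideal_gen_single smult_set_UNIV_mem q_def by auto
  qed
  have pq: "p \<in> m" "q \<in> m" unfolding p_def q_def using xs(3) by (auto intro!: subsetD[OF xs(1)] nth_mem)
  have "\<exists>k. y ^ k \<in> ideal_gen {p, q}" if y: "y \<in> m" for y
  proof (rule ccontr)
    assume no: "\<not> ?thesis"
    obtain P where P: "prime_ideal P" "ideal_gen {p, q} \<subseteq> P" "P \<inter> range (\<lambda>k. y ^ k) = {}"
    proof (rule prime_avoiding[OF ideal_gen_ideal])
      show "1 \<in> range (\<lambda>k. y ^ k)" by (auto intro: range_eqI[of _ _ 0])
      show "a * b \<in> range (\<lambda>k. y ^ k)" if "a \<in> range (\<lambda>k. y ^ k)" "b \<in> range (\<lambda>k. y ^ k)" for a b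
        using that by (auto simp flip: power_add)
      show "ideal_gen {p, q} \<inter> range (\<lambda>k. y ^ k) = {}" using no by auto
    qed
    have "P \<subseteq> m" using P(1) by (intro ideal_subset_m) (auto simp: prime_ideal_def)
    then have "P = m" using prime_containing_pair[OF dim m(1) P(1)] P(2) ideal_gen_superset[of "{p, q}"] by auto
    moreover have "y ^ 1 \<in> range (\<lambda>k. y ^ k)" by blast
    ultimately show False using P(3) y by auto
  qed
  then have "cm2_local m p q" using pq inf by unfold_locales auto
  then show ?thesis by blast
qed

section \<open>Ideals with two generators\<close>

text \<open>Every monomial of degree \<open>n + 1\<close> in \<open>a\<close> and \<open>b\<close>
  is divisible by \<open>a\<close>, except \<open>b^(n+1)\<close>.\<close>

lemma pair_ipow_Suc_subset:
  "ipow (ideal_gen {a, b}) (Suc n) \<subseteq> isum (smult_set a (ipow (ideal_gen {a, b}) n)) (smult_set (b ^ Suc n) UNIV)"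
proof (induction n)
  case 0
  show ?case by (simp add: pair_iprod ideal_UNIV)
next
  case (Suc n)
  let ?J = "ideal_gen {a, b}"
  let ?R = "isum (smult_set a (ipow ?J (Suc n))) (smult_set (b ^ Suc (Suc n)) UNIV)"
  have R: "is_ideal ?R" by (intro ideal_isum ideal_smult_set ideal_ipow ideal_UNIV)
  have "smult_set b (ipow ?J (Suc n)) \<subseteq> ?R"
  proof
    fix z assume "z \<in> smult_set b (ipow ?J (Suc n))"
    then obtain v where v: "v \<in> ipow ?J (Suc n)" "z = b * v" by (auto simp: smult_set_def)
    then obtain u r where u: "u \<in> ipow ?J n" "v = a * u + b ^ Suc n * r"
      using Suc by (fastforce simp: isum_def smult_set_def)
    have "b \<in> ?J" using ideal_gen_superset[of "{a, b}"] by auto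
    then have "b * u \<in> ipow ?J (Suc n)" using u by (simp add: iprodI)
    moreover have "z = a * (b * u) + b ^ Suc (Suc n) * r" using v u by (simp add: algebra_simps)
    ultimately show "z \<in> ?R" by (simp only:) (intro isumI, unfold smult_set_def, blast+)
  qed
  moreover have "ipow ?J (Suc (Suc n)) = isum (smult_set a (ipow ?J (Suc n))) (smult_set b (ipow ?J (Suc n)))"
    using pair_iprod[OF ideal_ipow, of a b ?J "Suc n"] by simp
  moreover have "smult_set a (ipow ?J (Suc n)) \<subseteq> ?R"
    by (intro isum_upper1 ideal_smult_set ideal_UNIV)
  ultimately show ?case using isum_least[OF R] by metis
qed

text \<open>The generators are the monomials of degree \<open>n\<close>, of which there are at most
  \<open>n + 1\<close> because some may coincide.\<close>

lemma pair_ipow_generators: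
  "\<exists>G. finite G \<and> card G \<le> Suc n \<and> G \<subseteq> ipow (ideal_gen {a, b}) n \<and> ipow (ideal_gen {a, b}) n \<subseteq> ideal_gen G"
proof (induction n)
  case 0
  have "ideal_gen {1} = (UNIV :: 'a set)" by (auto simp: ideal_gen_single smult_set_def)
  then show ?case by (intro exI[of _ "{1}"]) simp
next
  case (Suc n)
  let ?J = "ideal_gen {a, b}"
  have ab: "a \<in> ?J" "b \<in> ?J" using ideal_gen_superset[of "{a, b}"] by auto
  obtain G where G: "finite G" "card G \<le> Suc n" "G \<subseteq> ipow ?J n" "ipow ?J n \<subseteq> ideal_gen G"
    using Suc by blast
  let ?G = "insert (b ^ Suc n) ((\<lambda>g. a * g) ` G)"
  have "card ?G \<le> Suc (card ((\<lambda>g. a * g) ` G))" by (rule card_insert_le_m1) auto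
  also have "\<dots> \<le> Suc (Suc n)" using card_image_le[OF G(1)] G(2) by (meson le_trans Suc_le_mono)
  finally have "card ?G \<le> Suc (Suc n)" .
  moreover have "?G \<subseteq> ipow ?J (Suc n)"
    using G(3) ab ipow_mem_power[OF ideal_gen_ideal ab(2), of "Suc n"] by (auto intro: iprodI)
  moreover have "ipow ?J (Suc n) \<subseteq> ideal_gen ?G"
  proof (rule order.trans[OF pair_ipow_Suc_subset], intro isum_least ideal_gen_ideal)
    have sup: "?G \<subseteq> ideal_gen ?G" by (rule ideal_gen_superset)
    have "ideal_gen G \<subseteq> {z. a * z \<in> ideal_gen ?G}"
      using sup by (intro ideal_gen_least ideal_preimage_mult ideal_gen_ideal) auto
    then show "smult_set a (ipow ?J n) \<subseteq> ideal_gen ?G" using G(4) by (auto simp: smult_set_def)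
    show "smult_set (b ^ Suc n) UNIV \<subseteq> ideal_gen ?G"
      unfolding smult_set_def using sup by (intro image_subsetI ideal_mult_right[OF ideal_gen_ideal]) blast
  qed
  ultimately show ?case using G(1) by (intro exI[of _ ?G]) simp
qed

text \<open>The hypothesis says that the first Koszul homology of \<open>(a, b)\<close> vanishes.\<close>

locale koszul_pair =
  fixes a b :: "'a::comm_ring_1"
  assumes koszul: "r * a + s * b = 0 \<Longrightarrow> \<exists>t. r = t * b \<and> s = - (t * a)"
begin

abbreviation "J \<equiv> ideal_gen {a, b}"

lemma J_gens: "a \<in> J" "b \<in> J"
  using ideal_gen_superset[of "{a, b}"] by auto

lemma J_ideal: "is_ideal J"
  by (rule ideal_gen_ideal)

text \<open>Removing one factor \<open>b\<close> at a time by \<open>koszul\<close>: the relations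
  between \<open>a\<close> and \<open>b^n\<close> are again the trivial ones.\<close>

lemma koszul_power: "c * b ^ n = t * a \<Longrightarrow> \<exists>u. t = u * b ^ n"
proof (induction n arbitrary: t)
  case 0
  show ?case by simp
next
  case (Suc n)
  then have "t * a + (- (c * b ^ n)) * b = 0" by (simp add: algebra_simps)
  then obtain u where u: "t = u * b" "- (c * b ^ n) = - (u * a)" using koszul by blast
  then obtain v where "u = v * b ^ n" using Suc(1)[of u] by auto
  with u have "t = v * b ^ Suc n" by (simp add: algebra_simps)
  then show ?case by blast
qed

text \<open>Modulo \<open>a J^n\<close> the power \<open>J^(n+1)\<close> is generated by
  \<open>b^(n+1)\<close>, and \<open>koszul_power\<close> divides \<open>a\<close> out of the
  remaining relation. In other words, the initial form of \<open>a\<close> is regular on the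
  associated graded ring of \<open>J\<close>.\<close>

lemma power_colon_a:
  assumes "z * a \<in> ipow J (Suc n)"
  shows "z \<in> ipow J n"
proof -
  obtain u c where u: "u \<in> ipow J n" "z * a = a * u + b ^ Suc n * c"
    using subsetD[OF pair_ipow_Suc_subset assms] by (auto simp: isum_def smult_set_def simp del: power_Suc)
  have "c * b ^ Suc n = (z - u) * a" using u(2) by (simp add: algebra_simps)
  then obtain v where "z - u = v * b ^ Suc n" using koszul_power by blast
  then have "z - u = (v * b) * b ^ n" by (simp add: mult.assoc)
  then have "z - u \<in> ipow J n"
    using ideal_mult_left[OF ideal_ipow ipow_mem_power[OF J_ideal J_gens(2)]] by simp
  then show ?thesis using ideal_add[OF ideal_ipow u(1)] by fastforce
qed

lemma power_colon_a_power:
  assumes "z * a ^ k \<in> ipow J (n + k)"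
  shows "z \<in> ipow J n"
  using assms
proof (induction k)
  case 0
  then show ?case by simp
next
  case (Suc k)
  have "(z * a ^ k) * a \<in> ipow J (Suc (n + k))" using Suc(2) by (simp add: algebra_simps)
  then show ?case using Suc(1) power_colon_a by blast
qed

text \<open>Huneke's fundamental lemma, before \<open>K = I\<^sup>n\<close> turns it into a statement on second differences.\<close>

lemma len_iprod_colon:
  assumes K: "is_ideal K"
  shows "len (iprod J K) UNIV + len (icolon K J) UNIV = len J UNIV + 2 * len K UNIV"
proof -
  \<comment> \<open>With these ideals \<open>JK \<subseteq> D \<subseteq> J\<close>. Multiplication
    by \<open>b\<close> gives \<open>J/D\<close> isomorphic to \<open>R/T\<close> and
    \<open>W/K\<close> isomorphic to \<open>E/(K : J)\<close>; multiplication by \<open>a\<close>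
    gives \<open>D/JK\<close> isomorphic to \<open>R/W\<close> and \<open>T/K\<close> isomorphic to
    \<open>R/E\<close>. Exactness of the Koszul complex identifies the colons
    \<open>(D : b) = T\<close> and \<open>(JK : a) = W\<close>.\<close>
  define D where "D = isum (smult_set a UNIV) (smult_set b K)"
  define E where "E = {z. a * z \<in> K}"
  define T where "T = isum K (smult_set a UNIV)"
  define W where "W = isum K (smult_set b E)"
  note I = ideal_isum ideal_smult_set ideal_UNIV K
  have D: "is_ideal D" and E: "is_ideal E" and T: "is_ideal T"
    unfolding D_def E_def T_def by (intro I ideal_preimage_mult)+
  have W: "is_ideal W" unfolding W_def by (intro I E)
  have JK: "iprod J K = isum (smult_set a K) (smult_set b K)" by (rule pair_iprod[OF K])
  have sub: "smult_set c K \<subseteq> smult_set c UNIV" for c by (auto simp: smult_set_def)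
  have J_eq: "J = isum (smult_set a UNIV) (smult_set b UNIV)"
    by (simp add: ideal_gen_insert[of a] ideal_gen_single)
  have J_D: "isum D (smult_set b UNIV) = J"
    unfolding D_def J_eq isum_assoc using isum_absorb2[OF ideal_smult_set ideal_smult_set sub, of b] I by metis
  have D_JK: "isum (iprod J K) (smult_set a UNIV) = D"
    unfolding D_def JK isum_commute[of "smult_set a K"] isum_assoc
    using isum_absorb2[OF ideal_smult_set ideal_smult_set sub, of a] I
    by (metis isum_commute)
  have bT: "{z. b * z \<in> D} = T"
  proof
    show "{z. b * z \<in> D} \<subseteq> T"
    proof
      fix z assume "z \<in> {z. b * z \<in> D}"
      then obtain r k where rk: "k \<in> K" "b * z = a * r + b * k" by (auto simp: D_def isum_def smult_set_def)
      then have "r * a + (k - z) * b = 0" by (simp add: algebra_simps)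
      then obtain t where "k - z = - (t * a)" using koszul by blast
      then have "z = k + a * t" by (simp add: algebra_simps)
      then show "z \<in> T" using rk(1) by (auto simp: T_def isum_def smult_set_def)
    qed
    have "b * (k + a * r) \<in> D" if "k \<in> K" for k r
      using isumI[of "a * (b * r)" "smult_set a UNIV" "b * k" "smult_set b K"] that
      by (auto simp: D_def smult_set_def algebra_simps)
    then show "T \<subseteq> {z. b * z \<in> D}" by (auto simp: T_def isum_def smult_set_def)
  qed
  have aW: "{z. a * z \<in> iprod J K} = W"
  proof
    show "{z. a * z \<in> iprod J K} \<subseteq> W"
    proof
      fix z assume "z \<in> {z. a * z \<in> iprod J K}"
      then obtain k k' where k: "k \<in> K" "k' \<in> K" "a * z = a * k + b * k'"
        by (auto simp: JK isum_def smult_set_def)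
      then have "(z - k) * a + (- k') * b = 0" by (simp add: algebra_simps)
      then obtain t where t: "z - k = t * b" "- k' = - (t * a)" using koszul by blast
      then have "z = k + b * t" "a * t = k'" by (auto simp: algebra_simps)
      then show "z \<in> W" using k by (auto simp: W_def E_def isum_def smult_set_def)
    qed
    have "a * (k + b * t) \<in> iprod J K" if "k \<in> K" "a * t \<in> K" for k t
    proof -
      have "a * k + b * (a * t) \<in> iprod J K"
        unfolding JK smult_set_def by (intro isumI imageI that)
      then show ?thesis by (simp add: algebra_simps)
    qed
    then show "W \<subseteq> {z. a * z \<in> iprod J K}" by (auto simp: W_def E_def isum_def smult_set_def)
  qed
  have KJ: "icolon K J = E \<inter> {z. b * z \<in> K}"
    unfolding icolon_pair[OF K] E_def by (simp add: mult.commute)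
  note iJK = ideal_iprod[of J K]
  have C: "is_ideal (icolon K J)" by (rule ideal_icolon[OF K])
  have JK_D: "iprod J K \<subseteq> D" unfolding D_JK[symmetric] by (intro isum_upper1 I)
  have D_J: "D \<subseteq> J" unfolding J_D[symmetric] by (intro isum_upper1 I)
  have 1: "len D J = len T UNIV" using len_mult[OF ideal_UNIV D, of b] by (simp add: J_D bT)
  have 2: "len (iprod J K) D = len W UNIV" using len_mult[OF ideal_UNIV iJK, of a] by (simp add: D_JK aW)
  have 3: "len K T = len E UNIV" using len_mult[OF ideal_UNIV K, of a] by (simp add: T_def E_def)
  have 4: "len K W = len (icolon K J) E" using len_mult[OF E K, of b] by (simp add: W_def KJ)
  have KT: "K \<subseteq> T" and KW: "K \<subseteq> W" unfolding T_def W_def by (intro isum_upper1 I E)+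
  have CE: "icolon K J \<subseteq> E" using KJ by blast
  \<comment> \<open>Adding up, \<open>R/W\<close> combines with \<open>E/(K : J)\<close> and
    \<open>R/T\<close> with \<open>R/E\<close>; each pair contributes the length of
    \<open>R/K\<close> once.\<close>
  have "len (iprod J K) UNIV = len W UNIV + (len T UNIV + len J UNIV)"
    using len_add[OF iJK D ideal_UNIV JK_D] len_add[OF D J_ideal ideal_UNIV D_J] 1 2 by simp
  moreover have "len K UNIV = len E UNIV + len T UNIV"
    using len_add[OF K T ideal_UNIV KT] 3 by simp
  moreover have "len K UNIV = len (icolon K J) E + len W UNIV"
    using len_add[OF K W ideal_UNIV KW] 4 by simp
  moreover have "len (icolon K J) UNIV = len (icolon K J) E + len E UNIV"
    using len_add[OF C E ideal_UNIV CE] by simp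
  ultimately show ?thesis by (simp add: mult_2 ac_simps)
qed

end

section \<open>Ideals of finite colength\<close>

context cm2_local
begin

text \<open>Since \<open>(p, q)\<close> is primary to \<open>m\<close>, this says that \<open>R/A\<close> has finite length.\<close>

definition "finite_colength A \<longleftrightarrow> is_ideal A \<and> (\<exists>k. p ^ k \<in> A) \<and> (\<exists>l. q ^ l \<in> A)"

text \<open>The module \<open>m^n / m^(n+1)\<close> is finitely generated and annihilated by
  \<open>m\<close>, so its length is at most the number of generators.\<close>

lemma len_m_power: "len (ipow m n) UNIV \<noteq> \<infinity>"
proof (induction n)
  case 0
  show ?case by (simp add: len_self ideal_UNIV)
next
  case (Suc n)
  obtain G where G: "finite G" "ipow m n = ideal_gen G" using noeth[OF ideal_ipow] by blast
  have sub: "ipow m (Suc n) \<subseteq> ipow m n" by (rule ipow_decreasing) simp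
  have "len (ipow m (Suc n)) (isum (ipow m (Suc n)) (ideal_gen G)) \<le> of_nat (card G) * len m UNIV"
    using G(2) ideal_gen_superset[of G] by (intro len_gen_le ideal_ipow m_ideal G) (auto intro!: iprodI)
  also have "isum (ipow m (Suc n)) (ideal_gen G) = ipow m n"
    unfolding G(2)[symmetric] by (intro isum_absorb2 ideal_ipow sub)
  also have "of_nat (card G) * len m UNIV \<le> of_nat (card G) * 1"
    by (intro mult_left_mono len_maximal max) simp
  finally have "len (ipow m (Suc n)) (ipow m n) \<le> enat (card G)" by (simp add: of_nat_eq_enat)
  then have "len (ipow m (Suc n)) (ipow m n) \<noteq> \<infinity>"
    by (cases "len (ipow m (Suc n)) (ipow m n)") simp_all
  then show ?case
    using len_add[OF ideal_ipow ideal_ipow ideal_UNIV sub] Suc by auto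
qed

lemma len_pq: "\<exists>e. len (ideal_gen {p, q}) UNIV = enat e"
proof -
  obtain F where F: "finite F" "m = ideal_gen F" using noeth[OF m_ideal] by blast
  have "F \<subseteq> m" using F(2) ideal_gen_superset by blast
  then obtain N where N: "ipow m N \<subseteq> ideal_gen {p, q}"
    using ipow_gen_subset_of_powers[OF F(1) ideal_gen_ideal, of "{p, q}"] primary F(2) by blast
  have "len (ideal_gen {p, q}) UNIV \<le> len (ipow m N) UNIV"
    by (intro len_mono(2) ideal_ipow ideal_gen_ideal ideal_UNIV N) simp
  then show ?thesis using len_m_power[of N] by (cases "len (ideal_gen {p, q}) UNIV") auto
qed

text \<open>With \<open>Q = (p, q)\<close>, the layer \<open>Q^n / Q^(n+1)\<close> has at most
  \<open>n + 1\<close> generators annihilated by \<open>Q\<close>, hence length at most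
  \<open>(n + 1) e\<close>; the layers sum to at most \<open>e n^2\<close>.\<close>

lemma len_pq_power:
  assumes e: "len (ideal_gen {p, q}) UNIV = enat e"
  shows "len (ipow (ideal_gen {p, q}) n) UNIV \<le> enat (e * n ^ 2)"
proof (induction n)
  case 0
  show ?case by (simp add: len_self ideal_UNIV)
next
  case (Suc n)
  let ?Q = "ideal_gen {p, q}"
  obtain G where G: "finite G" "card G \<le> Suc n" "G \<subseteq> ipow ?Q n" "ipow ?Q n \<subseteq> ideal_gen G"
    using pair_ipow_generators by blast
  have sub: "ipow ?Q (Suc n) \<subseteq> ipow ?Q n" by (rule ipow_decreasing) simp
  have "ipow ?Q n \<subseteq> isum (ipow ?Q (Suc n)) (ideal_gen G)"
    using G(4) isum_upper2[OF ideal_ipow] by blast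
  then have "len (ipow ?Q (Suc n)) (ipow ?Q n) \<le> len (ipow ?Q (Suc n)) (isum (ipow ?Q (Suc n)) (ideal_gen G))"
    by (intro len_mono(1) ideal_isum ideal_ipow ideal_gen_ideal sub)
  also have "\<dots> \<le> of_nat (card G) * len ?Q UNIV"
    using G(3) by (intro len_gen_le ideal_ipow ideal_gen_ideal G) (auto intro!: iprodI)
  also have "\<dots> = enat (card G * e)" by (simp add: e of_nat_eq_enat)
  also have "\<dots> \<le> enat (Suc n * e)" using G(2) by (simp add: mult_le_mono1 del: mult_Suc)
  finally have "len (ipow ?Q (Suc n)) (ipow ?Q n) \<le> enat (Suc n * e)" .
  then have "len (ipow ?Q (Suc n)) UNIV \<le> enat (Suc n * e) + enat (e * n ^ 2)"
    unfolding len_add[OF ideal_ipow ideal_ipow ideal_UNIV sub subset_UNIV] using Suc by (rule add_mono)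
  also have "\<dots> \<le> enat (e * Suc n ^ 2)" by (simp add: power2_eq_square algebra_simps)
  finally show ?case .
qed

lemma finite_colength_pq_power:
  assumes "finite_colength A"
  shows "\<exists>N. ipow (ideal_gen {p, q}) N \<subseteq> A"
  using assms unfolding finite_colength_def by (intro ipow_gen_subset_of_powers) auto

lemma finite_colength_len:
  assumes "finite_colength A"
  shows "len A UNIV \<noteq> \<infinity>"
proof -
  obtain N where N: "ipow (ideal_gen {p, q}) N \<subseteq> A" using finite_colength_pq_power[OF assms] by blast
  obtain e where e: "len (ideal_gen {p, q}) UNIV = enat e" using len_pq by blast
  have "len A UNIV \<le> len (ipow (ideal_gen {p, q}) N) UNIV"
    using assms by (intro len_mono(2) ideal_ipow ideal_UNIV N) (auto simp: finite_colength_def)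
  also have "\<dots> \<le> enat (e * N ^ 2)" by (rule len_pq_power[OF e])
  finally show ?thesis by (cases "len A UNIV") simp_all
qed

lemma finite_colength_mono: "finite_colength A \<Longrightarrow> is_ideal B \<Longrightarrow> A \<subseteq> B \<Longrightarrow> finite_colength B"
  unfolding finite_colength_def by blast

lemma finite_colength_ipow:
  assumes "finite_colength A"
  shows "finite_colength (ipow A n)"
proof -
  obtain k l where "p ^ k \<in> A" "q ^ l \<in> A" and A: "is_ideal A" using assms by (auto simp: finite_colength_def)
  then have "(p ^ k) ^ n \<in> ipow A n" "(q ^ l) ^ n \<in> ipow A n" by (auto intro: ipow_mem_power)
  then show ?thesis unfolding finite_colength_def by (metis power_mult ideal_ipow)
qed

text \<open>\<open>I\<close> contains some \<open>(p, q)^N\<close>, so \<open>I^n\<close> contains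
  \<open>(p, q)^(N n)\<close>. This bound is what forbids three independent generators of a
  reduction.\<close>

lemma len_ipow_quadratic:
  assumes "finite_colength I"
  shows "\<exists>C. \<forall>n. len (ipow I n) UNIV \<le> enat (C * n ^ 2)"
proof -
  obtain N where N: "ipow (ideal_gen {p, q}) N \<subseteq> I" using finite_colength_pq_power[OF assms] by blast
  obtain e where e: "len (ideal_gen {p, q}) UNIV = enat e" using len_pq by blast
  have "len (ipow I n) UNIV \<le> enat (e * N ^ 2 * n ^ 2)" for n
  proof -
    have "ipow (ideal_gen {p, q}) (N * n) \<subseteq> ipow I n"
      using ipow_mono[OF N, of n] by (simp add: ipow_ipow)
    then have "len (ipow I n) UNIV \<le> len (ipow (ideal_gen {p, q}) (N * n)) UNIV"
      by (intro len_mono(2) ideal_ipow ideal_UNIV) auto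
    also have "\<dots> \<le> enat (e * (N * n) ^ 2)" by (rule len_pq_power[OF e])
    finally show ?thesis by (simp add: power_mult_distrib mult.assoc)
  qed
  then show ?thesis by blast
qed

lemma finite_colength_koszul: "finite_colength (ideal_gen {a, b}) \<Longrightarrow> koszul_pair a b"
  using koszul_exact unfolding finite_colength_def koszul_pair_def by blast

lemma finite_colength_not_principal:
  assumes "finite_colength A" "A \<subseteq> smult_set g UNIV" "g \<in> m"
  shows False
proof -
  obtain k l u v where "p ^ k = g * u" "q ^ l = g * v"
    using assms unfolding finite_colength_def by (metis subsetD smult_set_UNIV_mem)
  then obtain w where "g * w = 1" using powers_not_multiples by blast
  then show False using ideal_mult_right[OF m_ideal assms(3), of w] m_one by simp
qed

end

section \<open>Reductions\<close>

text \<open>Coefficients are indexed by \<open>S\<close> and not by the image, since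
  \<open>g\<close> may take equal values at different indices.\<close>

lemma finite_ideal_gen_sum:
  assumes "finite S" "z \<in> ideal_gen (g ` S)"
  shows "\<exists>r. z = (\<Sum>s\<in>S. r s * g s)"
proof -
  let ?A = "{\<Sum>s\<in>S. r s * g s | r. True}"
  have "is_ideal ?A"
    unfolding is_ideal_def
  proof (intro conjI ballI allI)
    show "0 \<in> ?A" by (intro CollectI exI[of _ "\<lambda>_. 0"]) simp
  next
    fix x y assume "x \<in> ?A" "y \<in> ?A"
    then obtain r r' where "x = (\<Sum>s\<in>S. r s * g s)" "y = (\<Sum>s\<in>S. r' s * g s)" by blast
    then have "x + y = (\<Sum>s\<in>S. (r s + r' s) * g s)" by (simp add: distrib_right sum.distrib)
    then show "x + y \<in> ?A" by (intro CollectI exI[of _ "\<lambda>s. r s + r' s"]) simp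
  next
    fix c x assume "x \<in> ?A"
    then obtain r where "x = (\<Sum>s\<in>S. r s * g s)" by blast
    then have "c * x = (\<Sum>s\<in>S. (c * r s) * g s)" by (simp add: sum_distrib_left mult.assoc)
    then show "c * x \<in> ?A" by (intro CollectI exI[of _ "\<lambda>s. c * r s"]) simp
  qed
  moreover have "g ` S \<subseteq> ?A"
  proof
    fix y assume "y \<in> g ` S"
    then obtain s where s: "s \<in> S" "y = g s" by blast
    have "(\<Sum>u\<in>S. (if u = s then 1 else 0) * g u) = (\<Sum>u\<in>S. if u = s then g u else 0)"
      by (rule sum.cong) auto
    also have "\<dots> = y" using assms(1) s by simp
    finally show "y \<in> ?A" by (intro CollectI exI[of _ "\<lambda>u. if u = s then 1 else 0"]) simp
  qed
  ultimately have "ideal_gen (g ` S) \<subseteq> ?A" by (rule ideal_gen_least)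
  then show ?thesis using assms(2) by blast
qed

lemma reduction_ipow:
  assumes "iprod J (ipow I r) = ipow I (Suc r)"
  shows "iprod (ipow J n) (ipow I r) = ipow I (n + r)"
proof (induction n)
  case 0
  show ?case by (simp add: UNIV_iprod ideal_ipow)
next
  case (Suc n)
  have "iprod (ipow J (Suc n)) (ipow I r) = iprod J (ipow I (n + r))"
    by (simp add: iprod_assoc Suc)
  also have "\<dots> = iprod (iprod J (ipow I r)) (ipow I n)"
    by (subst add.commute) (simp add: ipow_add iprod_assoc)
  also have "\<dots> = ipow I (Suc n + r)"
    unfolding assms by (subst ipow_add[symmetric]) (simp add: add.commute)
  finally show ?case .
qed

lemma reduction_ipow_ge:
  assumes "iprod J (ipow I r) = ipow I (Suc r)" "r \<le> n"
  shows "iprod J (ipow I n) = ipow I (Suc n)"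
proof -
  have "iprod J (ipow I n) = iprod (iprod J (ipow I r)) (ipow I (n - r))"
    using assms(2) by (simp add: iprod_assoc ipow_add[symmetric])
  also have "\<dots> = ipow I (Suc n)"
    unfolding assms(1) ipow_add[symmetric] using assms(2) by simp
  finally show ?thesis .
qed

context noetherian_local
begin

text \<open>The hypothesis is linear independence over the residue field modulo \<open>D\<close>. A
  generator lying in \<open>D\<close> plus the span of the others would give a relation with
  coefficient \<open>1\<close>, which is not in \<open>m\<close>, so every added generator enlarges
  the ideal strictly.\<close>

lemma len_independent:
  assumes "finite S" and D: "is_ideal D"
    and indep: "\<And>c s. (\<Sum>s\<in>S. c s * g s) \<in> D \<Longrightarrow> s \<in> S \<Longrightarrow> c s \<in> m"
  shows "ichain D (isum D (ideal_gen (g ` S))) (card S)"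
  using assms(1,3)
proof (induction S)
  case empty
  then show ?case
    using D by (simp add: ideal_gen_empty isum_absorb1 ideal_zero_set ideal_zero ichain_refl)
next
  case (insert u S)
  let ?E = "isum D (ideal_gen (g ` S))"
  have E: "is_ideal ?E" by (intro ideal_isum D ideal_gen_ideal)
  have "c s \<in> m" if "(\<Sum>s\<in>S. c s * g s) \<in> D" "s \<in> S" for c s
  proof -
    have "(\<Sum>v\<in>S. (if v = u then 0 else c v) * g v) = (\<Sum>v\<in>S. c v * g v)"
      using insert(2) by (intro sum.cong) auto
    then have "(\<Sum>v\<in>insert u S. (if v = u then 0 else c v) * g v) \<in> D"
      using that(1) insert(1,2) by simp
    from insert(4)[OF this, of s] show "c s \<in> m" using that(2) insert(2) by (auto split: if_splits)
  qed
  then have ch: "ichain D ?E (card S)" by (rule insert(3))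
  have "g u \<notin> ?E"
  proof
    assume "g u \<in> ?E"
    then obtain d z where dz: "d \<in> D" "z \<in> ideal_gen (g ` S)" "g u = d + z" by (auto simp: isum_def)
    then obtain r where r: "z = (\<Sum>s\<in>S. r s * g s)" using finite_ideal_gen_sum insert(1) by blast
    have "(\<Sum>v\<in>S. (if v = u then 1 else - r v) * g v) = (\<Sum>v\<in>S. - (r v * g v))"
      using insert(2) by (intro sum.cong) auto
    then have "(\<Sum>v\<in>insert u S. (if v = u then 1 else - r v) * g v) = d"
      using insert(1,2) dz(3) r by (simp add: sum_negf)
    from insert(4)[of "\<lambda>v. if v = u then 1 else - r v", unfolded this, OF dz(1), of u]
    show False using m_one by simp
  qed
  moreover have "g u \<in> isum D (ideal_gen (g ` insert u S))"
    using isum_upper2[OF D] ideal_gen_superset[of "g ` insert u S"] by blast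
  moreover have "ideal_gen (g ` S) \<subseteq> ideal_gen (g ` insert u S)"
    using ideal_gen_superset[of "g ` insert u S"] by (intro ideal_gen_least ideal_gen_ideal) auto
  then have "?E \<subseteq> isum D (ideal_gen (g ` insert u S))" by (intro isum_mono) auto
  ultimately have "?E \<subset> isum D (ideal_gen (g ` insert u S))" by blast
  from ichain_step[OF ch ideal_isum[OF D ideal_gen_ideal] this]
  show ?case using insert(1,2) by simp
qed

text \<open>Over the field \<open>R/m\<close> a polynomial with infinitely many roots vanishes. The
  argument stays in \<open>R\<close>, dividing by \<open>X - c\<close> and using that
  \<open>m\<close> is prime and \<open>T\<close> pairwise incongruent.\<close>

lemma poly_coeffs_in_m:
  assumes "degree f \<le> n" "infinite T" "\<And>s t. s \<in> T \<Longrightarrow> t \<in> T \<Longrightarrow> s \<noteq> t \<Longrightarrow> s - t \<notin> m"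
    "\<And>t. t \<in> T \<Longrightarrow> poly f t \<in> m"
  shows "coeff f i \<in> m"
  using assms
proof (induction n arbitrary: f T i)
  case 0
  then obtain t c where "t \<in> T" "f = [:c:]"
    by (metis infinite_imp_nonempty ex_in_conv le_zero_eq degree_eq_zeroE)
  then show ?case using 0(4)[of t] ideal_zero[OF m_ideal] by (cases i) auto
next
  case (Suc n)
  obtain c where c: "c \<in> T" using Suc(3) infinite_imp_nonempty by blast
  let ?g = "synthetic_div f c"
  have g: "coeff ?g i \<in> m" for i
  proof (rule Suc(1)[of ?g "T - {c}"])
    show "degree ?g \<le> n" using Suc(2) by (simp add: degree_synthetic_div)
    show "infinite (T - {c})" using Suc(3) by simp
    show "s - t \<notin> m" if "s \<in> T - {c}" "t \<in> T - {c}" "s \<noteq> t" for s t using Suc(4) that by blast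
    fix t assume t: "t \<in> T - {c}"
    have "poly ([:- c, 1:] * ?g + [:poly f c:]) t = poly f t" by (simp only: synthetic_div_correct')
    then have "(t - c) * poly ?g t = poly f t - poly f c" by (simp add: algebra_simps)
    also have "\<dots> \<in> m" using Suc(5) c t by (intro ideal_diff[OF m_ideal]) auto
    finally show "poly ?g t \<in> m" using m_prime Suc(4)[of t c] t c by (auto simp: prime_ideal_def)
  qed
  have "f = pCons (poly f c) ?g - smult c ?g" using synthetic_div_correct[of f c] by (simp add: eq_diff_eq)
  then have "coeff f i = coeff (pCons (poly f c) ?g) i - c * coeff ?g i" by (metis coeff_diff coeff_smult)
  moreover have "coeff (pCons (poly f c) ?g) i \<in> m" using g Suc(5)[OF c] by (cases i) auto
  ultimately show ?case using ideal_diff[OF m_ideal] ideal_mult_left[OF m_ideal] g by metis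
qed

lemma unit_value:
  assumes inf: "infinite_residue_field m" and "c i \<notin> m" "i \<le> n"
  shows "\<exists>t. (\<Sum>i\<le>n. c i * t ^ i) \<notin> m"
proof -
  let ?cos = "\<lambda>x. {x + y | y. y \<in> m}"
  \<comment> \<open>A set of representatives of the residue classes modulo \<open>m\<close>.\<close>
  obtain T where T: "inj_on ?cos T" "range ?cos = ?cos ` T"
    using iffD1[OF subset_image_inj, of "range ?cos" ?cos UNIV] by auto
  have T_inf: "infinite T"
  proof
    assume "finite T"
    then have "finite (range ?cos)" unfolding T(2) by (rule finite_imageI)
    then show False using inf by (simp add: infinite_residue_field_def)
  qed
  have incong: "s - t \<notin> m" if "s \<in> T" "t \<in> T" "s \<noteq> t" for s t
  proof
    assume st: "s - t \<in> m"
    have "?cos x \<subseteq> ?cos y" if "x - y \<in> m" for x y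
    proof
      fix z assume "z \<in> ?cos x"
      then obtain w where w: "w \<in> m" "z = x + w" by blast
      then have "z = y + (x - y + w)" "x - y + w \<in> m" using that by (auto intro: ideal_add[OF m_ideal])
      then show "z \<in> ?cos y" by blast
    qed
    moreover have "t - s \<in> m" using ideal_uminus[OF m_ideal st] by simp
    ultimately have "?cos s = ?cos t" using st by blast
    then show False using T(1) that by (auto dest: inj_onD)
  qed
  define f where "f = (\<Sum>i\<le>n. monom (c i) i)"
  have "coeff f i = c i" using assms(3) by (simp add: f_def coeff_sum)
  then obtain t where "poly f t \<notin> m" using poly_coeffs_in_m[OF order.refl T_inf incong, of f i] assms(2) by auto
  then show ?thesis by (auto simp: f_def poly_sum poly_monom)
qed

end

context cm2_local
begin

text \<open>For each \<open>k\<close> only the \<open>(k + 1)^2\<close> monomials of degree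
  \<open>2k\<close> with \<open>i, j \<le> k\<close> are considered, so the exponent of
  \<open>a3\<close> never truncates. Were they independent modulo \<open>m I^(2k)\<close> for all
  \<open>k\<close>, the lengths of \<open>I^(2k) / I^(2k+2)\<close> would add up to cubic growth,
  against \<open>len_ipow_quadratic\<close>.\<close>

lemma monomial_relation:
  assumes I: "finite_colength I" "I \<subseteq> m" and a: "a1 \<in> I" "a2 \<in> I" "a3 \<in> I"
  shows "\<exists>k c. (\<Sum>(i, j)\<in>{..k} \<times> {..k}. c (i, j) * (a1 ^ i * a2 ^ j * a3 ^ (2 * k - i - j)))
        \<in> iprod m (ipow I (2 * k)) \<and> (\<exists>i\<le>k. \<exists>j\<le>k. c (i, j) \<notin> m)"
proof (rule ccontr)
  assume no: "\<not> ?thesis"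
  have Ii: "is_ideal I" using I(1) by (simp add: finite_colength_def)
  have step: "enat ((k + 1) ^ 2) \<le> len (ipow I (2 * Suc k)) (ipow I (2 * k))" for k
  proof -
    let ?S = "{..k} \<times> {..k}" and ?D = "iprod m (ipow I (2 * k))"
    define g where "g = (\<lambda>(i, j). a1 ^ i * a2 ^ j * a3 ^ (2 * k - i - j))"
    have eq: "(\<Sum>s\<in>?S. c s * g s) = (\<Sum>(i, j)\<in>?S. c (i, j) * (a1 ^ i * a2 ^ j * a3 ^ (2 * k - i - j)))" for c
      by (rule sum.cong) (auto simp: g_def)
    have "ichain ?D (isum ?D (ideal_gen (g ` ?S))) (card ?S)"
    proof (rule len_independent)
      show "c s \<in> m" if "(\<Sum>s\<in>?S. c s * g s) \<in> ?D" "s \<in> ?S" for c s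
        using no that unfolding eq by (cases s) auto
    qed (auto intro: ideal_iprod)
    then have "enat (card ?S) \<le> len ?D (isum ?D (ideal_gen (g ` ?S)))" by (rule len_upper)
    also have "card ?S = (k + 1) ^ 2" by (simp add: power2_eq_square)
    also have "len ?D (isum ?D (ideal_gen (g ` ?S))) \<le> len ?D (ipow I (2 * k))"
    proof (intro len_mono(1) ideal_isum ideal_iprod ideal_gen_ideal ideal_ipow isum_least isum_upper1
        iprod_subset_right ideal_gen_least)
      show "g ` ?S \<subseteq> ipow I (2 * k)"
      proof
        fix z assume "z \<in> g ` ?S"
        then obtain i j where ij: "i \<le> k" "j \<le> k" "z = a1 ^ i * a2 ^ j * a3 ^ (2 * k - i - j)"
          by (auto simp: g_def)
        have "z \<in> ipow I (i + j + (2 * k - i - j))" unfolding ij(3)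
          by (intro ipow_mult_mem ipow_mem_power Ii a)
        then show "z \<in> ipow I (2 * k)" using ij(1,2) by simp
      qed
    qed
    also have "\<dots> \<le> len (ipow I (2 * Suc k)) (ipow I (2 * k))"
    proof (intro len_mono(2) ideal_ipow ideal_iprod iprod_subset_right)
      have "ipow I (2 * Suc k) \<subseteq> ipow I (Suc (2 * k))" by (rule ipow_decreasing) simp
      also have "\<dots> \<subseteq> ?D" using I(2) by (auto intro: subsetD[OF iprod_mono])
      finally show "ipow I (2 * Suc k) \<subseteq> ?D" .
    qed
    finally show ?thesis .
  qed
  \<comment> \<open>Adds \<open>j\<close> consecutive layers starting at \<open>n\<close>, each of
    length at least \<open>n^2\<close>.\<close>
  have lower: "enat (j * n ^ 2) \<le> len (ipow I (2 * (n + j))) UNIV" for n j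
  proof (induction j)
    case 0
    show ?case by (simp add: zero_enat_def[symmetric])
  next
    case (Suc j)
    have "n ^ 2 \<le> (n + j + 1) ^ 2" by (intro power_mono) auto
    then have "enat (n ^ 2) \<le> len (ipow I (2 * Suc (n + j))) (ipow I (2 * (n + j)))"
      using order.trans[OF _ step[of "n + j"], of "enat (n ^ 2)"] by simp
    from add_mono[OF this Suc]
    have "enat (n ^ 2) + enat (j * n ^ 2) \<le> len (ipow I (2 * Suc (n + j))) UNIV"
      by (subst len_add[OF ideal_ipow ideal_ipow ideal_UNIV ipow_decreasing subset_UNIV]) auto
    then show ?case by simp
  qed
  obtain C where C: "\<And>n. len (ipow I n) UNIV \<le> enat (C * n ^ 2)"
    using len_ipow_quadratic[OF I(1)] by blast
  \<comment> \<open>With \<open>j = n\<close> the lower bound is \<open>n^3\<close> and the upper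
    one \<open>C (4n)^2 = 16 C n^2\<close>, so any \<open>n > 16 C\<close> contradicts.\<close>
  define n where "n = 16 * C + 1"
  have "enat (n * n ^ 2) \<le> enat (C * (2 * (n + n)) ^ 2)"
    using order.trans[OF lower C] .
  then have "n * n ^ 2 \<le> C * (2 * (n + n)) ^ 2" unfolding enat_ord_simps .
  also have "\<dots> = (16 * C) * n ^ 2" by (simp add: power2_eq_square)
  finally have "n \<le> 16 * C" unfolding mult_le_cancel2 by (simp add: n_def)
  then show False by (simp add: n_def)
qed

text \<open>A relation between the monomials in \<open>a1, a2, a3\<close> modulo \<open>m I^n\<close> becomes integral over
  \<open>(b1, b2)\<close> after a linear change of variables making the coefficient of \<open>a3 ^ n\<close> a unit.\<close>

lemma reduction_drop_generator:
  assumes I: "finite_colength I" "I \<subseteq> m"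
    and red: "is_reduction (ideal_gen (insert a1 (insert a2 (insert a3 S)))) I"
  shows "\<exists>b1 b2. is_reduction (ideal_gen (insert b1 (insert b2 S))) I \<and>
    ideal_gen (insert b1 (insert b2 S)) \<subseteq> ideal_gen (insert a1 (insert a2 (insert a3 S)))"
proof -
  let ?J = "ideal_gen (insert a1 (insert a2 (insert a3 S)))"
  have J: "is_ideal ?J" by (rule ideal_gen_ideal)
  have Ii: "is_ideal I" using I(1) by (simp add: finite_colength_def)
  obtain r where r: "iprod ?J (ipow I r) = ipow I (Suc r)" and JI: "?J \<subseteq> I"
    using red by (auto simp: is_reduction_def)
  have aJ: "a1 \<in> ?J" "a2 \<in> ?J" "a3 \<in> ?J" "S \<subseteq> ?J"
    using ideal_gen_superset[of "insert a1 (insert a2 (insert a3 S))"] by auto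
  then have aI: "a1 \<in> I" "a2 \<in> I" "a3 \<in> I" using JI by auto
  obtain k c i0 j0 where
    rel: "(\<Sum>(i, j)\<in>{..k} \<times> {..k}. c (i, j) * (a1 ^ i * a2 ^ j * a3 ^ (2 * k - i - j))) \<in> iprod m (ipow I (2 * k))"
    and c: "i0 \<le> k" "j0 \<le> k" "c (i0, j0) \<notin> m"
    using monomial_relation[OF I aI] by blast
  \<comment> \<open>The two variables are specialised one after the other: \<open>t2\<close> makes
    the coefficient of index \<open>i0\<close> a unit, after which \<open>t1\<close> makes the whole
    value a unit.\<close>
  obtain t2 where t2: "(\<Sum>j\<le>k. c (i0, j) * t2 ^ j) \<notin> m"
    using unit_value[OF inf_res, of "\<lambda>j. c (i0, j)"] c by blast
  obtain t1 where t1: "(\<Sum>i\<le>k. (\<Sum>j\<le>k. c (i, j) * t2 ^ j) * t1 ^ i) \<notin> m"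
    using unit_value[OF inf_res, of "\<lambda>i. (\<Sum>j\<le>k. c (i, j) * t2 ^ j)"] c t2 by blast
  \<comment> \<open>The coefficient of \<open>a3^(2k)\<close> in the relation after substituting
    \<open>a1 = b1 + t1 a3\<close> and \<open>a2 = b2 + t2 a3\<close>.\<close>
  define u where "u = (\<Sum>(i, j)\<in>{..k} \<times> {..k}. c (i, j) * (t1 ^ i * t2 ^ j))"
  have "u = (\<Sum>i\<le>k. (\<Sum>j\<le>k. c (i, j) * t2 ^ j) * t1 ^ i)"
    unfolding u_def sum.cartesian_product[symmetric]
    by (simp add: sum_distrib_right mult.assoc mult.commute[of "t2 ^ _"])
  then have u: "u \<notin> m" using t1 by simp
  define b1 where "b1 = a1 - t1 * a3"
  define b2 where "b2 = a2 - t2 * a3"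
  let ?J' = "ideal_gen (insert b1 (insert b2 S))"
  have J': "is_ideal ?J'" by (rule ideal_gen_ideal)
  have bJ': "b1 \<in> ?J'" "b2 \<in> ?J'" "S \<subseteq> ?J'"
    using ideal_gen_superset[of "insert b1 (insert b2 S)"] by auto
  have J'J: "?J' \<subseteq> ?J"
    using aJ by (intro ideal_gen_least J) (auto simp: b1_def b2_def intro!: ideal_diff[OF J] ideal_mult_left[OF J])
  have J_sub: "?J \<subseteq> isum ?J' (smult_set a3 UNIV)"
  proof (rule ideal_gen_least)
    show i: "is_ideal (isum ?J' (smult_set a3 UNIV))" by (intro ideal_isum J' ideal_smult_set ideal_UNIV)
    have a3: "a3 * r \<in> smult_set a3 UNIV" for r by (auto simp: smult_set_def)
    have "b1 + a3 * t1 \<in> isum ?J' (smult_set a3 UNIV)" "b2 + a3 * t2 \<in> isum ?J' (smult_set a3 UNIV)"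
      "0 + a3 * 1 \<in> isum ?J' (smult_set a3 UNIV)"
      using bJ' a3 ideal_zero[OF J'] by (blast intro: isumI)+
    moreover have "S \<subseteq> isum ?J' (smult_set a3 UNIV)"
      using bJ'(3) isum_upper1[OF ideal_smult_set[OF ideal_UNIV]] by blast
    ultimately show "insert a1 (insert a2 (insert a3 S)) \<subseteq> isum ?J' (smult_set a3 UNIV)"
      by (simp add: b1_def b2_def mult.commute)
  qed
  \<comment> \<open>Error terms of degree \<open>n\<close>, namely \<open>J' I^(n-1)\<close> where
    \<open>J'\<close> is the new ideal. The value zero in degree \<open>0\<close> makes congruences
    modulo \<open>D\<close> multiplicative in all degrees.\<close>
  define D where "D n = (case n of 0 \<Rightarrow> {0} | Suc n' \<Rightarrow> iprod ?J' (ipow I n'))" for n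
  have D: "is_ideal (D n)" for n by (cases n) (auto simp: D_def intro: ideal_zero_set ideal_iprod)
  have D_mult: "x * y \<in> D (i + j)" if "x \<in> D i" "y \<in> ipow I j" for x y i j
  proof (cases i)
    case 0
    then show ?thesis using that(1) ideal_zero[OF D] by (simp add: D_def)
  next
    case (Suc i')
    then have "x * y \<in> iprod (iprod ?J' (ipow I i')) (ipow I j)" using that by (intro iprodI) (auto simp: D_def)
    then show ?thesis using Suc by (simp add: D_def iprod_assoc ipow_add)
  qed
  have D1: "D (Suc 0) = ?J'" by (simp add: D_def iprod_UNIV J')
  have congr: "x * y - x' * y' \<in> D (i + j)"
    if "x' \<in> ipow I i" "y \<in> ipow I j" "x - x' \<in> D i" "y - y' \<in> D j" for x x' y y' i j
  proof -
    have "x * y - x' * y' = (x - x') * y + (y - y') * x'" by (simp add: algebra_simps)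
    moreover have "(x - x') * y \<in> D (i + j)" "(y - y') * x' \<in> D (i + j)"
      using D_mult[OF that(3,2)] D_mult[OF that(4,1)] by (simp_all add: add.commute)
    ultimately show ?thesis using ideal_add[OF D] by metis
  qed
  have congr_power: "x ^ i - y ^ i \<in> D i" if "x \<in> I" "y \<in> I" "x - y \<in> ?J'" for x y i
  proof (induction i)
    case 0
    show ?case by (simp add: D_def)
  next
    case (Suc i)
    then show ?case using congr[of y "Suc 0" "x ^ i" i x "y ^ i"] that
      by (simp add: D1 ipow_mem_power Ii iprod_UNIV)
  qed
  have ta: "t1 * a3 \<in> I" "t2 * a3 \<in> I" using aI ideal_mult_left[OF Ii] by auto
  have mono: "a1 ^ i * a2 ^ j * a3 ^ l - t1 ^ i * t2 ^ j * a3 ^ (i + j + l) \<in> D (i + j + l)" for i j l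
  proof -
    have "a1 ^ i * a2 ^ j * a3 ^ l - (t1 * a3) ^ i * (t2 * a3) ^ j * a3 ^ l \<in> D (i + j + l)"
      using congr_power[OF aI(1) ta(1)] congr_power[OF aI(2) ta(2)] bJ' ideal_zero[OF D] aI ta
      by (intro congr ipow_mult_mem ipow_mem_power Ii) (auto simp: b1_def b2_def)
    then show ?thesis by (simp add: power_mult_distrib power_add algebra_simps)
  qed
  let ?n = "2 * k"
  let ?E = "isum (D ?n) (iprod m (ipow I ?n))"
  have E: "is_ideal ?E" by (intro ideal_isum D ideal_iprod)
  \<comment> \<open>Modulo \<open>D (2k)\<close> each monomial becomes a multiple of
    \<open>a3^(2k)\<close>, so the relation collapses to \<open>u a3^(2k)\<close>, and
    \<open>u\<close> is a unit.\<close>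
  have "(\<Sum>(i, j)\<in>{..k} \<times> {..k}. c (i, j) * (a1 ^ i * a2 ^ j * a3 ^ (2 * k - i - j))) - u * a3 ^ ?n
      = (\<Sum>(i, j)\<in>{..k} \<times> {..k}. c (i, j) * (a1 ^ i * a2 ^ j * a3 ^ (2 * k - i - j) - t1 ^ i * t2 ^ j * a3 ^ ?n))"
    unfolding u_def sum_distrib_right sum_subtractf[symmetric] by (rule sum.cong) (auto simp: algebra_simps)
  also have "\<dots> \<in> D ?n"
  proof (rule ideal_sum[OF D], clarify)
    fix i j assume "i \<le> k" "j \<le> k"
    then show "c (i, j) * (a1 ^ i * a2 ^ j * a3 ^ (2 * k - i - j) - t1 ^ i * t2 ^ j * a3 ^ ?n) \<in> D ?n"
      using mono[of i j "2 * k - i - j"] by (intro ideal_mult_left[OF D]) simp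
  qed
  finally have "u * a3 ^ ?n - (\<Sum>(i, j)\<in>{..k} \<times> {..k}. c (i, j) * (a1 ^ i * a2 ^ j * a3 ^ (2 * k - i - j))) \<in> D ?n"
    using ideal_uminus[OF D] by fastforce
  from isumI[OF this rel] have "u * a3 ^ ?n \<in> ?E" by simp
  then have a3E: "a3 ^ ?n \<in> ?E" using unit_cancel[OF E u] by blast
  \<comment> \<open>A positive degree is required for \<open>D ?n\<close> to be the product of the
    new ideal with a power of \<open>I\<close>; in degree \<open>0\<close> the relation would put
    \<open>1\<close> into \<open>m\<close>.\<close>
  have k0: "k \<noteq> 0"
  proof
    assume "k = 0"
    then have "1 \<in> m" using a3E by (simp add: D_def isum_absorb2 ideal_zero_set m_ideal ideal_zero iprod_UNIV)
    then show False using m_one by simp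
  qed
  have "ipow ?J n \<subseteq> isum (D n) (smult_set (a3 ^ n) UNIV)" for n
  proof (induction n)
    case 0
    show ?case using isum_upper2[OF D, of "smult_set 1 UNIV" 0] by (auto simp: smult_set_def)
  next
    case (Suc n)
    have "iprod ?J (ipow ?J n) \<subseteq> isum (D (Suc n)) (smult_set (a3 ^ Suc n) UNIV)"
    proof (intro iprod_least ideal_isum D ideal_smult_set ideal_UNIV)
      fix x y assume x: "x \<in> ?J" and y: "y \<in> ipow ?J n"
      obtain j s where j: "j \<in> ?J'" "x = j + a3 * s" using J_sub x by (fastforce simp: isum_def smult_set_def)
      obtain d s' where d: "d \<in> D n" "y = d + a3 ^ n * s'" using Suc y by (fastforce simp: isum_def smult_set_def)
      have "j * y \<in> D (Suc n)" using D_mult[of j "Suc 0" y n] j(1) D1 y ipow_mono[OF JI] by auto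
      moreover have "d * (a3 * s) \<in> D (n + 1)"
        by (intro D_mult d) (use aI ideal_mult_right[OF Ii] in \<open>simp add: iprod_UNIV Ii\<close>)
      ultimately have "j * y + d * (a3 * s) \<in> D (Suc n)" using ideal_add[OF D] by simp
      moreover have "x * y = (j * y + d * (a3 * s)) + a3 ^ Suc n * (s * s')"
        unfolding j(2) by (simp add: d(2) algebra_simps)
      ultimately show "x * y \<in> isum (D (Suc n)) (smult_set (a3 ^ Suc n) UNIV)"
        by (simp only:) (intro isumI, simp_all add: smult_set_def)
    qed
    then show ?case by simp
  qed
  then have "ipow ?J ?n \<subseteq> isum (D ?n) (smult_set (a3 ^ ?n) UNIV)" .
  also have "\<dots> \<subseteq> ?E"
    using a3E by (intro isum_least E isum_upper1 ideal_iprod) (auto simp: smult_set_def intro: ideal_mult_right[OF E])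
  finally have JE: "ipow ?J ?n \<subseteq> ?E" .
  obtain n' where n': "?n = Suc n'" using k0 by (cases k) auto
  \<comment> \<open>Multiplying by \<open>I^r\<close> gives \<open>I^(2k+r)\<close> inside
    \<open>J' I^(2k-1+r) + m I^(2k+r)\<close>, and Nakayama's lemma removes the last
    summand.\<close>
  have "ipow I (?n + r) = iprod (ipow ?J ?n) (ipow I r)" by (rule reduction_ipow[OF r, symmetric])
  also have "\<dots> \<subseteq> iprod ?E (ipow I r)" by (intro iprod_mono JE order.refl)
  also have "\<dots> \<subseteq> isum (iprod (D ?n) (ipow I r)) (iprod (iprod m (ipow I ?n)) (ipow I r))"
    by (intro isum_iprod_subset D ideal_iprod)
  also have "\<dots> = isum (iprod ?J' (ipow I (n' + r))) (iprod m (ipow I (?n + r)))"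
    by (simp add: D_def n' iprod_assoc ipow_add)
  finally have "ipow I (?n + r) \<subseteq> iprod ?J' (ipow I (n' + r))"
    by (rule nakayama[OF ideal_ipow ideal_iprod])
  moreover have "iprod ?J' (ipow I (n' + r)) \<subseteq> iprod I (ipow I (n' + r))"
    using J'J JI by (intro iprod_mono) auto
  ultimately have "iprod ?J' (ipow I (n' + r)) = ipow I (Suc (n' + r))" unfolding n' by auto
  then have "is_reduction ?J' I" unfolding is_reduction_def using J' J'J JI by blast
  then show ?thesis using J'J by blast
qed

text \<open>Generators are dropped until two remain; shorter lists are padded by \<open>0\<close> or
  by repetition. Lists are used because their length drops even when generators coincide.\<close>

lemma reduction_contains_pair:
  assumes I: "finite_colength I" "I \<subseteq> m" and K: "is_reduction K I"
  shows "\<exists>a b. is_reduction (ideal_gen {a, b}) I \<and> ideal_gen {a, b} \<subseteq> K"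
proof -
  have list: "is_reduction (ideal_gen (set xs)) I \<Longrightarrow>
    \<exists>a b. is_reduction (ideal_gen {a, b}) I \<and> ideal_gen {a, b} \<subseteq> ideal_gen (set xs)" for xs
  proof (induction "length xs" arbitrary: xs rule: less_induct)
    case less
    consider "xs = []" | a where "xs = [a]" | a b where "xs = [a, b]" | a b c ys where "xs = a # b # c # ys"
      by (metis neq_Nil_conv)
    then show ?case
    proof cases
      case 1
      have "ideal_gen {0, 0} = ideal_gen (set xs)"
        using 1 by (simp add: ideal_gen_empty ideal_gen_single) (auto simp: smult_set_def)
      then show ?thesis using less(2) by (metis order.refl)
    next
      case (2 a)
      then have "ideal_gen {a, a} = ideal_gen (set xs)" by simp
      then show ?thesis using less(2) by (metis order.refl)
    next
      case (3 a b)
      then have "ideal_gen {a, b} = ideal_gen (set xs)" by simp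
      then show ?thesis using less(2) by (metis order.refl)
    next
      case (4 a b c ys)
      then obtain b1 b2 where b: "is_reduction (ideal_gen (set (b1 # b2 # ys))) I"
        "ideal_gen (set (b1 # b2 # ys)) \<subseteq> ideal_gen (set xs)"
        using reduction_drop_generator[OF I, of a b c "set ys"] less(2) by auto
      have "length (b1 # b2 # ys) < length xs" using 4 by simp
      from less(1)[OF this b(1)] show ?thesis using b(2) by blast
    qed
  qed
  obtain F where F: "finite F" "K = ideal_gen F" using noeth[of K] K unfolding is_reduction_def by blast
  obtain xs where "set xs = F" using finite_list F(1) by blast
  then show ?thesis using list[of xs] K F(2) by simp
qed

text \<open>A reduction properly inside \<open>J = (a, b)\<close> spans at most a line modulo
  \<open>m J\<close>, so it lies in \<open>(g) + m J\<close> for some \<open>g\<close> in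
  \<open>J\<close>. By Nakayama's lemma some power of \<open>I\<close> then lies in
  \<open>(g)\<close>, which is impossible for an ideal of finite colength.\<close>

lemma pair_reduction_minimal:
  assumes I: "finite_colength I" "I \<subseteq> m" and J: "is_reduction (ideal_gen {a, b}) I"
  shows "minimal_reduction (ideal_gen {a, b}) I"
  unfolding minimal_reduction_def
proof (intro conjI J allI impI)
  fix K assume K: "is_reduction K I \<and> K \<subseteq> ideal_gen {a, b}"
  let ?J = "ideal_gen {a, b}"
  have Ki: "is_ideal K" using K by (simp add: is_reduction_def)
  have JI: "?J \<subseteq> I" using J by (simp add: is_reduction_def)
  obtain n where n: "iprod K (ipow I n) = ipow I (Suc n)" using K by (auto simp: is_reduction_def)
  have no_principal: False if g: "g \<in> ?J" "K \<subseteq> isum (smult_set g UNIV) (iprod m ?J)" for g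
  proof -
    have gi: "is_ideal (smult_set g UNIV)" by (intro ideal_smult_set ideal_UNIV)
    have "ipow I (Suc n) \<subseteq> iprod (isum (smult_set g UNIV) (iprod m ?J)) (ipow I n)"
      unfolding n[symmetric] using g(2) by (intro iprod_mono) auto
    also have "\<dots> \<subseteq> isum (iprod (smult_set g UNIV) (ipow I n)) (iprod (iprod m ?J) (ipow I n))"
      by (intro isum_iprod_subset gi ideal_iprod)
    also have "\<dots> \<subseteq> isum (smult_set g UNIV) (iprod m (ipow I (Suc n)))"
      unfolding iprod_assoc using JI by (intro isum_mono iprod_subset_left gi iprod_mono) (auto intro: subsetD[OF iprod_mono])
    finally have "ipow I (Suc n) \<subseteq> smult_set g UNIV" by (rule nakayama[OF ideal_ipow gi])
    then show False
      using finite_colength_not_principal[OF finite_colength_ipow[OF I(1)]] g(1) JI I(2) by blast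
  qed
  \<comment> \<open>If \<open>K\<close> contains an element with a unit coefficient at
    \<open>a\<close>, then either \<open>K\<close> is spanned by it modulo \<open>m J\<close>, or
    \<open>K\<close> contains \<open>b\<close> and hence \<open>a\<close>. The generators are
    quantified anew so that their roles can be exchanged.\<close>
  have unit_coeff: "?J \<subseteq> K" if g: "a * \<alpha> + b * \<beta> \<in> K" "\<alpha> \<notin> m" and ab: "ideal_gen {a, b} = ?J" for a b \<alpha> \<beta>
  proof (rule ccontr)
    assume not: "\<not> ?thesis"
    obtain \<alpha>' where \<alpha>': "\<alpha> * \<alpha>' = 1" using unit g(2) by blast
    let ?g = "a * \<alpha> + b * \<beta>"
    have abJ: "b \<in> ?J" using ideal_gen_superset[of "{a, b}"] ab by auto
    have "K \<subseteq> isum (smult_set ?g UNIV) (iprod m ?J)"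
    proof
      fix h assume h: "h \<in> K"
      then obtain \<gamma> \<delta> where "h = a * \<gamma> + b * \<delta>" using K ab by (metis ideal_gen_pair_mem subsetD)
      moreover have "a * \<gamma> = a * \<gamma> * (\<alpha> * \<alpha>')" by (simp add: \<alpha>')
      ultimately have h_eq: "h = ?g * (\<alpha>' * \<gamma>) + (\<delta> - \<beta> * \<alpha>' * \<gamma>) * b" by (simp add: algebra_simps)
      have "\<delta> - \<beta> * \<alpha>' * \<gamma> \<in> m"
      proof (rule ccontr)
        assume "\<delta> - \<beta> * \<alpha>' * \<gamma> \<notin> m"
        moreover have "(\<delta> - \<beta> * \<alpha>' * \<gamma>) * b \<in> K"
          using ideal_diff[OF Ki h ideal_mult_right[OF Ki g(1), of "\<alpha>' * \<gamma>"]] h_eq by simp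
        ultimately have bK: "b \<in> K" using unit_cancel[OF Ki] by blast
        then have "\<alpha> * a \<in> K"
          using ideal_diff[OF Ki g(1) ideal_mult_right[OF Ki bK, of \<beta>]] by (simp add: mult.commute)
        then have "a \<in> K" using unit_cancel[OF Ki g(2)] by blast
        then show False using not ideal_gen_least[OF Ki, of "{a, b}"] bK ab by auto
      qed
      then show "h \<in> isum (smult_set ?g UNIV) (iprod m ?J)"
        using abJ by (subst h_eq) (intro isumI iprodI, simp_all add: smult_set_def)
    qed
    then show False using no_principal[of ?g] g(1) K by blast
  qed
  have "?J \<subseteq> K"
  proof (rule ccontr)
    assume not: "\<not> ?thesis"
    \<comment> \<open>Without unit coefficients \<open>K\<close> lies in \<open>m J\<close>, which
      is the excluded case with \<open>g = 0\<close>.\<close>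
    have "K \<subseteq> isum (smult_set 0 UNIV) (iprod m ?J)"
    proof
      fix h assume h: "h \<in> K"
      then obtain \<gamma> \<delta> where h_eq: "h = a * \<gamma> + b * \<delta>" using K by (metis ideal_gen_pair_mem subsetD)
      have "\<gamma> \<in> m" using unit_coeff[of a \<gamma> b \<delta>] h h_eq not by auto
      moreover have "\<delta> \<in> m" using unit_coeff[of b \<delta> a \<gamma>] h h_eq not
        by (auto simp: insert_commute add.commute)
      moreover have "a \<in> ?J" "b \<in> ?J" using ideal_gen_superset[of "{a, b}"] by auto
      ultimately have "\<gamma> * a + \<delta> * b \<in> iprod m ?J" by (intro ideal_add ideal_iprod iprodI)
      then have "h \<in> iprod m ?J" by (simp add: h_eq mult.commute)
      then show "h \<in> isum (smult_set 0 UNIV) (iprod m ?J)"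
        using isum_upper2[OF ideal_smult_set[OF ideal_UNIV]] by blast
    qed
    then show False using no_principal[of 0] ideal_zero[OF ideal_gen_ideal] by blast
  qed
  then show "K = ?J" using K by blast
qed

text \<open>A minimal reduction exists, so the \<open>LEAST\<close> is attained; the two-generated
  reduction inside an optimal one equals it by minimality.\<close>

lemma reduction_number_attained:
  assumes I: "finite_colength I" "I \<subseteq> m"
  shows "\<exists>a b. ideal_gen {a, b} \<subseteq> I \<and>
    iprod (ideal_gen {a, b}) (ipow I (reduction_number I)) = ipow I (Suc (reduction_number I))"
proof -
  have Ii: "is_ideal I" using I(1) by (simp add: finite_colength_def)
  have "is_reduction I I" unfolding is_reduction_def using Ii by (auto intro: exI[of _ 0])
  then obtain a0 b0 where "is_reduction (ideal_gen {a0, b0}) I" using reduction_contains_pair[OF I] by blast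
  then have "minimal_reduction (ideal_gen {a0, b0}) I" by (rule pair_reduction_minimal[OF I])
  then have "\<exists>r J. minimal_reduction J I \<and> r = red_number J I" by blast
  from LeastI_ex[OF this] have "\<exists>J. minimal_reduction J I \<and> reduction_number I = red_number J I"
    unfolding reduction_number_def .
  then obtain J where J: "minimal_reduction J I" "reduction_number I = red_number J I" by blast
  then have red: "is_reduction J I" by (simp add: minimal_reduction_def)
  obtain a b where ab: "is_reduction (ideal_gen {a, b}) I" "ideal_gen {a, b} \<subseteq> J"
    using reduction_contains_pair[OF I red] by blast
  then have "ideal_gen {a, b} = J" using J(1) by (simp add: minimal_reduction_def)
  moreover have "iprod J (ipow I (red_number J I)) = ipow I (Suc (red_number J I))"
    unfolding red_number_def by (rule LeastI_ex) (use red in \<open>simp add: is_reduction_def\<close>)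
  moreover have "J \<subseteq> I" using red by (simp add: is_reduction_def)
  ultimately show ?thesis using J(2) by metis
qed

end

section \<open>Hilbert functions and Ratliff--Rush closures\<close>

lemma rat_poly_eqI:
  fixes P Q :: "rat poly"
  assumes "\<And>t::int. N \<le> t \<Longrightarrow> poly P (of_int t) = poly Q (of_int t)"
  shows "P = Q"
proof (rule ccontr)
  assume "P \<noteq> Q"
  then have "finite {x. poly (P - Q) x = 0}" by (intro poly_roots_finite) simp
  moreover have "of_int ` {N..} \<subseteq> {x. poly (P - Q) x = 0}" using assms by auto
  ultimately have "finite ((of_int :: int \<Rightarrow> rat) ` {N..})" by (rule rev_finite_subset)
  then have "finite {N..}" by (rule finite_imageD) (auto intro: injI inj_onI)
  then show False by (simp add: infinite_Ici)
qed

text \<open>\<open>P\<close> is Newton's form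
  \<open>H(s) + d (t - s) + e (t - s)(t - s - 1) / 2\<close>. Its second difference is
  \<open>e\<close> at every integer, also below \<open>s\<close>, so that \<open>P\<close> can be
  compared with \<open>H\<close> to the left of \<open>s\<close>.\<close>

lemma eventually_quadratic:
  fixes H :: "int \<Rightarrow> int"
  assumes "\<And>t. s < t \<Longrightarrow> H (t + 1) - 2 * H t + H (t - 1) = e"
  shows "\<exists>P :: rat poly. (\<forall>t\<ge>s. poly P (of_int t) = of_int (H t)) \<and>
    (\<forall>t::int. poly P (of_int (t + 1)) - 2 * poly P (of_int t) + poly P (of_int (t - 1)) = of_int e)"
proof -
  define d where "d = H (s + 1) - H s"
  have diff: "H (s + int k + 1) - H (s + int k) = d + e * int k" for k
  proof (induction k)
    case 0
    show ?case by (simp add: d_def)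
  next
    case (Suc k)
    then show ?case using assms[of "s + int k + 1"] by (simp add: algebra_simps)
  qed
  have quad: "2 * H (s + int k) = 2 * H s + 2 * d * int k + e * int k * (int k - 1)" for k
  proof (induction k)
    case 0
    show ?case by simp
  next
    case (Suc k)
    have "2 * H (s + int (Suc k)) = 2 * H (s + int k) + 2 * (d + e * int k)"
      using diff[of k] by (simp add: algebra_simps)
    then show ?case using Suc by (simp add: algebra_simps)
  qed
  define P :: "rat poly" where "P = [:of_int (H s):] + smult (of_int d) [:- of_int s, 1:]
    + smult (of_int e / 2) ([:- of_int s, 1:] * [:- of_int s - 1, 1:])"
  have P: "poly P x = of_int (H s) + of_int d * (x - of_int s)
      + of_int e / 2 * ((x - of_int s) * (x - of_int s - 1))" for x
    by (simp add: P_def algebra_simps)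
  have "poly P (of_int t) = of_int (H t)" if st: "s \<le> t" for t
  proof -
    obtain k where k: "t = s + int k" using st zle_iff_zadd[of s t] by blast
    define y :: rat where "y = of_int (int k)"
    have "rat_of_int (2 * H t) = of_int (2 * H s + 2 * d * int k + e * int k * (int k - 1))"
      unfolding k quad ..
    then have "2 * rat_of_int (H t) = 2 * of_int (H s) + 2 * of_int d * y + of_int e * y * (y - 1)"
      unfolding y_def by simp
    moreover have "poly P (of_int t) = of_int (H s) + of_int d * y + of_int e / 2 * (y * (y - 1))"
      unfolding P k y_def by simp
    then have "2 * poly P (of_int t) = 2 * of_int (H s) + 2 * of_int d * y + of_int e * y * (y - 1)"
      by simp
    ultimately show ?thesis by simp
  qed
  moreover have "poly P (of_int (t + 1)) - 2 * poly P (of_int t) + poly P (of_int (t - 1)) = of_int e" for t :: int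
    unfolding P by (simp add: field_simps)
  ultimately show ?thesis by blast
qed

lemma hs_poly_eq:
  assumes "\<And>t. s \<le> t \<Longrightarrow> poly P (of_int t) = of_int (hilbert_samuel I t)"
  shows "hs_poly I = P"
  unfolding hs_poly_def
proof (rule the_equality)
  show "\<forall>\<^sub>F t in at_top. poly P (of_int t) = of_int (hilbert_samuel I t)"
    unfolding eventually_at_top_linorder using assms by blast
  fix Q :: "rat poly" assume "\<forall>\<^sub>F t in at_top. poly Q (of_int t) = of_int (hilbert_samuel I t)"
  then obtain N where "\<And>t. N \<le> t \<Longrightarrow> poly Q (of_int t) = of_int (hilbert_samuel I t)"
    unfolding eventually_at_top_linorder by blast
  then show "Q = P" using assms by (intro rat_poly_eqI[of "max N s"]) auto
qed

text \<open>The bound \<open>l\<close> shifts \<open>S\<close> into the naturals, where a least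
  element exists; this makes the infimum defining \<open>postulation\<close> attained.\<close>

lemma int_Inf_mem:
  fixes S :: "int set"
  assumes "n \<in> S" "\<And>k. k \<in> S \<Longrightarrow> l \<le> k"
  shows "Inf S \<in> S" "k \<in> S \<Longrightarrow> Inf S \<le> k"
proof -
  define i where "i = (LEAST i::nat. l + int i \<in> S)"
  have "l + int (nat (n - l)) \<in> S" using assms by simp
  then have i: "l + int i \<in> S" unfolding i_def by (rule LeastI)
  have le: "l + int i \<le> k" if "k \<in> S" for k
  proof -
    have "l + int (nat (k - l)) \<in> S" using that assms(2)[OF that] by simp
    then have "i \<le> nat (k - l)" unfolding i_def by (rule Least_le)
    then show ?thesis using assms(2)[OF that] by linarith
  qed
  have "Inf S = l + int i" by (rule cInf_eq_minimum[OF i le])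
  then show "Inf S \<in> S" "k \<in> S \<Longrightarrow> Inf S \<le> k" using i le by auto
qed

section \<open>Hilbert function and Ratliff-Rush closures along a two-generated reduction\<close>

locale pair_reduction = cm2_local m p q + koszul_pair a b for m :: "'a::comm_ring_1 set" and p q a b :: 'a +
  fixes I :: "'a set" and r :: nat
  assumes I_fin: "finite_colength I" and I_m: "I \<subseteq> m"
    and J_I: "J \<subseteq> I" and red: "iprod J (ipow I r) = ipow I (Suc r)"
begin

lemma I_ideal: "is_ideal I"
  using I_fin by (simp add: finite_colength_def)

lemma J_fin: "finite_colength J"
proof (rule finite_colength_mono[OF finite_colength_ipow[OF I_fin] J_ideal])
  show "ipow I (Suc r) \<subseteq> J" unfolding red[symmetric] by (rule iprod_subset_left[OF J_ideal])
qed

text \<open>The length of \<open>R/A\<close> as an integer, so that differences can be formed; it is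
  meaningful when that length is finite.\<close>

definition L :: "'a set \<Rightarrow> int" where "L A = int (the_enat (len A UNIV))"

lemma len_L: "finite_colength A \<Longrightarrow> len A UNIV = enat (nat (L A))"
  using finite_colength_len[of A] by (auto simp: L_def)

lemma L_nonneg: "0 \<le> L A"
  by (simp add: L_def)

lemma L_inject:
  assumes "finite_colength A" "is_ideal B" "A \<subseteq> B" "L A = L B"
  shows "A = B"
proof (rule ccontr)
  assume "A \<noteq> B"
  have A: "is_ideal A" using assms(1) by (simp add: finite_colength_def)
  have "1 \<le> len A B" using len_pos[OF A assms(2)] \<open>A \<noteq> B\<close> assms(3) by blast
  moreover have "len A UNIV = len A B + len B UNIV"
    by (rule len_add[OF A assms(2) ideal_UNIV assms(3) subset_UNIV])
  ultimately show False
    using len_L[OF assms(1)] len_L[OF finite_colength_mono[OF assms(1-3)]] assms(4)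
    by (cases "len A B") (auto simp: one_enat_def)
qed

lemma hilbert_L: "hilbert_samuel I t = L (ipow I (nat t))"
  by (simp add: hilbert_samuel_def L_def colength_eq_len)

lemma L_UNIV: "L UNIV = 0"
  by (simp add: L_def len_self ideal_UNIV zero_enat_def)

lemma L_J_pos: "0 < L J"
proof (rule ccontr)
  assume "\<not> 0 < L J"
  then have "L J = L UNIV" using L_nonneg[of J] by (simp add: L_UNIV)
  then have "J = UNIV" using L_inject[OF J_fin ideal_UNIV] by blast
  then show False using J_I I_m m_one by auto
qed

lemma colon_fin: "finite_colength (icolon (ipow I n) J)"
proof (rule finite_colength_mono[OF finite_colength_ipow[OF I_fin]])
  show "ipow I n \<subseteq> icolon (ipow I n) J"
    by (auto simp: icolon_def intro: ideal_mult_right[OF ideal_ipow])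
qed (rule ideal_icolon[OF ideal_ipow])

text \<open>This is \<open>len_iprod_colon\<close> for \<open>K = I^t\<close>, where
  \<open>J I^t = I^(t+1)\<close> since \<open>t\<close> is at least \<open>r\<close>. It is the true
  second difference of the Hilbert function exactly when \<open>(I^t : J)\<close> has the colength
  of \<open>I^(t-1)\<close>.\<close>

lemma second_difference:
  assumes "int r \<le> t"
  shows "hilbert_samuel I (t + 1) - 2 * hilbert_samuel I t + L (icolon (ipow I (nat t)) J) = L J"
proof -
  let ?n = "nat t"
  have n: "nat (t + 1) = Suc ?n" "r \<le> ?n" using assms by auto
  have "len (iprod J (ipow I ?n)) UNIV + len (icolon (ipow I ?n) J) UNIV = len J UNIV + 2 * len (ipow I ?n) UNIV"
    by (rule len_iprod_colon[OF ideal_ipow])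
  then have "len (ipow I (Suc ?n)) UNIV + len (icolon (ipow I ?n) J) UNIV = len J UNIV + 2 * len (ipow I ?n) UNIV"
    using reduction_ipow_ge[OF red n(2)] by simp
  then have "nat (L (ipow I (Suc ?n))) + nat (L (icolon (ipow I ?n) J)) = nat (L J) + 2 * nat (L (ipow I ?n))"
    unfolding len_L[OF finite_colength_ipow[OF I_fin]] len_L[OF colon_fin] len_L[OF J_fin]
    by (simp add: mult_2)
  then show ?thesis unfolding hilbert_L n(1)
    using L_nonneg[of "ipow I (Suc ?n)"] L_nonneg[of "icolon (ipow I ?n) J"] L_nonneg[of J] L_nonneg[of "ipow I ?n"]
    by linarith
qed

lemma ipow_subset_colon: "ipow I (nat (t - 1)) \<subseteq> icolon (ipow I (nat t)) J"
proof -
  have "y * j \<in> ipow I (nat t)" if "y \<in> ipow I (nat (t - 1))" "j \<in> J" for y j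
  proof -
    have "j * y \<in> ipow I (Suc (nat (t - 1)))" using that J_I by (auto intro: iprodI)
    \<comment> \<open>An equality for \<open>t\<close> at least \<open>1\<close>; for smaller
      \<open>t\<close> both powers involved in the claim are the whole ring.\<close>
    moreover have "nat t \<le> Suc (nat (t - 1))" by linarith
    ultimately show ?thesis using ipow_decreasing by (metis mult.commute subsetD)
  qed
  then show ?thesis by (auto simp: icolon_def)
qed

lemma colon_eq_iff:
  "L (icolon (ipow I (nat t)) J) = hilbert_samuel I (t - 1) \<longleftrightarrow> icolon (ipow I (nat t)) J = ipow I (nat (t - 1))"
  unfolding hilbert_L
  using L_inject[OF finite_colength_ipow[OF I_fin] ideal_icolon[OF ideal_ipow] ipow_subset_colon] by metis

text \<open>The union of the colons \<open>(I^(n+k) : I^k)\<close>, which is the Ratliff-Rush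
  closure of \<open>I^n\<close> for positive \<open>n\<close>, without restricting \<open>k\<close>
  to multiples of \<open>n\<close>. For \<open>n = 0\<close> it is the whole ring.\<close>

definition F :: "nat \<Rightarrow> 'a set" where
  "F n = {z. \<exists>k. \<forall>y\<in>ipow I k. z * y \<in> ipow I (n + k)}"

lemma ipow_subset_F: "ipow I n \<subseteq> F n"
proof
  fix z assume "z \<in> ipow I n"
  then have "\<forall>y\<in>ipow I 0. z * y \<in> ipow I (n + 0)" by (auto intro: ideal_mult_right[OF ideal_ipow])
  then show "z \<in> F n" unfolding F_def by blast
qed

lemma F_weaken:
  assumes z: "\<forall>y\<in>ipow I k. z * y \<in> ipow I (n + k)" and "k \<le> k'" "y \<in> ipow I k'"
  shows "z * y \<in> ipow I (n + k')"
proof -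
  have "iprod (ipow I k) (ipow I (k' - k)) \<subseteq> {y. z * y \<in> ipow I (n + k')}"
  proof (intro iprod_least ideal_preimage_mult ideal_ipow CollectI)
    fix u v assume "u \<in> ipow I k" "v \<in> ipow I (k' - k)"
    then have "(z * u) * v \<in> ipow I (n + k + (k' - k))" using z by (intro ipow_mult_mem[of "z * u"]) auto
    then show "z * (u * v) \<in> ipow I (n + k')" using assms(2) by (simp add: mult.assoc)
  qed
  then show ?thesis using assms(2,3) by (auto simp: ipow_add[symmetric])
qed

lemma F_mult:
  assumes "z \<in> F n" "j \<in> I"
  shows "z * j \<in> F (Suc n)"
proof -
  obtain k where k: "\<forall>y\<in>ipow I k. z * y \<in> ipow I (n + k)" using assms(1) by (auto simp: F_def)
  have "z * j * y \<in> ipow I (Suc n + k)" if "y \<in> ipow I k" for y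
    using F_weaken[OF k, of "Suc k" "j * y"] iprodI[OF assms(2) that] by (simp add: mult.assoc)
  then show ?thesis by (auto simp: F_def)
qed

text \<open>The colons defining the closure of \<open>I^n\<close> are those in \<open>F n\<close>
  with exponent a multiple of \<open>n\<close>. By \<open>F_weaken\<close> any exponent
  \<open>k\<close> may be raised to such a multiple, here \<open>n (k + 1)\<close>.\<close>

lemma ratliff_rush_eq_F:
  assumes "0 < n"
  shows "ratliff_rush (ipow I n) = F n"
proof
  show "ratliff_rush (ipow I n) \<subseteq> F n"
  proof
    fix z assume "z \<in> ratliff_rush (ipow I n)"
    then obtain k where "z \<in> icolon (ipow (ipow I n) (Suc k)) (ipow (ipow I n) k)"
      by (auto simp: ratliff_rush_def)
    then have "\<forall>y\<in>ipow I (n * k). z * y \<in> ipow I (n + n * k)"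
      unfolding ipow_ipow by (simp add: icolon_def)
    then show "z \<in> F n" unfolding F_def by blast
  qed
  show "F n \<subseteq> ratliff_rush (ipow I n)"
  proof
    fix z assume "z \<in> F n"
    then obtain k where k: "\<forall>y\<in>ipow I k. z * y \<in> ipow I (n + k)" by (auto simp: F_def)
    have "k \<le> Suc k" by simp
    also have "\<dots> \<le> n * Suc k" using assms by (cases n) simp_all
    finally have "z \<in> icolon (ipow (ipow I n) (Suc (Suc k))) (ipow (ipow I n) (Suc k))"
      unfolding ipow_ipow icolon_def using F_weaken[OF k, of "n * Suc k"] by simp
    then show "z \<in> ratliff_rush (ipow I n)" unfolding ratliff_rush_def by (intro UN_I[of "Suc k"]) auto
  qed
qed

text \<open>If \<open>z J\<close> lies in \<open>I^(n+1)\<close>, then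
  \<open>z I^(r+1) = z J I^r\<close> lies in \<open>I^(n+1+r)\<close>, so \<open>k = r + 1\<close>
  works.\<close>

lemma colon_subset_F: "icolon (ipow I (Suc n)) J \<subseteq> F n"
proof
  fix z assume z: "z \<in> icolon (ipow I (Suc n)) J"
  have "iprod J (ipow I r) \<subseteq> {y. z * y \<in> ipow I (n + Suc r)}"
  proof (intro iprod_least ideal_preimage_mult ideal_ipow CollectI)
    fix j v assume "j \<in> J" "v \<in> ipow I r"
    then have "(z * j) * v \<in> ipow I (Suc n + r)" using z by (intro ipow_mult_mem) (auto simp: icolon_def)
    then show "z * (j * v) \<in> ipow I (n + Suc r)" by (simp add: mult.assoc)
  qed
  then show "z \<in> F n" unfolding F_def red by (intro CollectI exI[of _ "Suc r"]) auto
qed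

text \<open>\<open>I^(n+k) = J^(n-r+k) I^r\<close> lies in \<open>J^(n-r+k)\<close>, where
  \<open>a^k\<close> can be cancelled. The loss of \<open>r\<close> degrees is harmless: the result
  only has to place the closure inside the \<open>I^c\<close> of the superficiality
  condition.\<close>

lemma F_subset_shift:
  assumes "r \<le> n"
  shows "F n \<subseteq> ipow I (n - r)"
proof
  fix z assume "z \<in> F n"
  then obtain k where k: "\<forall>y\<in>ipow I k. z * y \<in> ipow I (n + k)" by (auto simp: F_def)
  have "a ^ k \<in> ipow I k" using J_gens J_I by (intro ipow_mem_power I_ideal) auto
  then have "z * a ^ k \<in> ipow I (n + k)" using k by blast
  also have "ipow I (n + k) = iprod (ipow J (n - r + k)) (ipow I r)"
    using reduction_ipow[OF red, of "n - r + k"] assms by simp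
  also have "\<dots> \<subseteq> ipow J (n - r + k)" by (rule iprod_subset_left[OF ideal_ipow])
  finally have "z \<in> ipow J (n - r)" by (rule power_colon_a_power)
  then show "z \<in> ipow I (n - r)" using ipow_mono[OF J_I] by blast
qed

text \<open>From \<open>n = c + r\<close> on, \<open>F_subset_shift\<close> puts \<open>z\<close>
  into \<open>I^c\<close>, so superficiality cancels the factors of \<open>x^k\<close> from
  \<open>z x^k\<close> one by one.\<close>

lemma F_eventually:
  assumes "superficial I x"
  shows "\<exists>N. \<forall>n\<ge>N. F n = ipow I n"
proof -
  obtain c where x: "x \<in> I" and c: "\<And>n. c \<le> n \<Longrightarrow> icolon (ipow I (Suc n)) {x} \<inter> ipow I c = ipow I n"
    using assms by (auto simp: superficial_def)
  have "F n \<subseteq> ipow I n" if n: "c + r \<le> n" for n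
  proof
    fix z assume z: "z \<in> F n"
    then obtain k where k: "\<forall>y\<in>ipow I k. z * y \<in> ipow I (n + k)" by (auto simp: F_def)
    have "z \<in> ipow I (n - r)" using F_subset_shift[of n] n z by auto
    then have zc: "z \<in> ipow I c" using ipow_decreasing[of c "n - r" I] n by (meson add_le_imp_le_diff subsetD)
    have "z * x ^ k \<in> ipow I (n + k)" using k ipow_mem_power[OF I_ideal x] by blast
    then show "z \<in> ipow I n"
    proof (induction k)
      case 0
      then show ?case by simp
    next
      case (Suc k)
      have "z * x ^ k \<in> icolon (ipow I (Suc (n + k))) {x}"
        using Suc(2) by (simp add: icolon_def algebra_simps)
      moreover have "z * x ^ k \<in> ipow I c" using zc by (rule ideal_mult_right[OF ideal_ipow])
      ultimately have "z * x ^ k \<in> ipow I (n + k)" using c[of "n + k"] n by auto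
      then show ?case by (rule Suc(1))
    qed
  qed
  then show ?thesis using ipow_subset_F by blast
qed

lemma postulation_bound:
  assumes x: "superficial I x" and ne: "postulation I \<noteq> int (rr_index I) - 1"
  shows "postulation I + 2 \<le> int r"
proof (rule ccontr)
  assume contra: "\<not> ?thesis"
  obtain N where N: "\<And>n. N \<le> n \<Longrightarrow> F n = ipow I n" using F_eventually[OF x] by blast
  let ?H = "hilbert_samuel I"
  \<comment> \<open>Beyond this index both \<open>J I^t = I^(t+1)\<close> and the equality of
    \<open>I^t\<close> with its closure hold.\<close>
  let ?s = "int (max N r)"
  have "?H (t + 1) - 2 * ?H t + ?H (t - 1) = L J" if t: "?s < t" for t
  proof -
    have n: "nat t = Suc (nat (t - 1))" "N \<le> nat (t - 1)" using t by auto
    have "icolon (ipow I (nat t)) J \<subseteq> ipow I (nat (t - 1))"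
      using colon_subset_F[of "nat (t - 1)"] N[OF n(2)] n(1) by simp
    then have "L (icolon (ipow I (nat t)) J) = ?H (t - 1)" using ipow_subset_colon colon_eq_iff by blast
    then show ?thesis using second_difference[of t] t by simp
  qed
  from eventually_quadratic[of ?s ?H "L J", OF this] obtain P :: "rat poly"
    where P: "\<And>t. ?s \<le> t \<Longrightarrow> poly P (of_int t) = of_int (?H t)"
      and P2: "\<And>t::int. poly P (of_int (t + 1)) - 2 * poly P (of_int t) + poly P (of_int (t - 1)) = of_int (L J)"
    by blast
  have hs: "hs_poly I = P" using P by (rule hs_poly_eq)
  define S where "S = {n :: int. \<forall>t > n. poly P (of_int t) = of_int (?H t)}"
  define n where "n = postulation I"
  have n_Inf: "n = Inf S" by (simp add: n_def postulation_def S_def hs)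
  have "?s \<in> S" using P by (auto simp: S_def)
  \<comment> \<open>\<open>S\<close> is bounded below: agreement at \<open>-2, -1, 0\<close>, where
    the Hilbert function is zero, would make the second difference of \<open>P\<close> zero, but it
    is the positive length of \<open>R/J\<close>.\<close>
  moreover have "- 3 \<le> k" if "k \<in> S" for k
  proof (rule ccontr)
    assume "\<not> - 3 \<le> k"
    then have "poly P (of_int t) = 0" if "- 3 \<le> t" "t \<le> 0" for t
      using \<open>k \<in> S\<close> that by (auto simp: S_def hilbert_L L_UNIV)
    from this[of 0] this[of "-1"] this[of "-2"] have "of_int (L J) = (0::rat)" using P2[of "-1"] by simp
    then show False using L_J_pos by simp
  qed
  ultimately have nS: "n \<in> S" and n_least: "\<And>k. k \<in> S \<Longrightarrow> n \<le> k"
    unfolding n_Inf using int_Inf_mem[of ?s S "- 3"] by blast+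
  have PH: "poly P (of_int t) = of_int (?H t)" if "n < t" for t using nS that by (auto simp: S_def)
  have PH_n: "poly P (of_int n) \<noteq> of_int (?H n)"
  proof
    assume "poly P (of_int n) = of_int (?H n)"
    then have "n - 1 \<in> S" using PH by (auto simp: S_def) (metis linorder_cases not_less zle_diff1_eq zless_imp_add1_zle)
    then show False using n_least by fastforce
  qed
  have r_n: "int r \<le> n + 1" using contra by (simp add: n_def)
  \<comment> \<open>For these \<open>t\<close> both \<open>t\<close> and \<open>t + 1\<close> exceed
    \<open>n\<close>, and \<open>t\<close> is at least \<open>r\<close>; comparing the two second
    differences leaves the colon length against \<open>P(t - 1)\<close>.\<close>
  have colon_P: "of_int (L (icolon (ipow I (nat t)) J)) = poly P (of_int (t - 1))" if "n + 1 \<le> t" for t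
  proof -
    have "of_int (?H (t + 1)) - 2 * of_int (?H t) + of_int (L (icolon (ipow I (nat t)) J)) = (of_int (L J) :: rat)"
      using second_difference[of t] r_n that by (simp flip: of_int_add of_int_diff)
    moreover have "poly P (of_int (t + 1)) = of_int (?H (t + 1))" "poly P (of_int t) = of_int (?H t)"
      using that by (auto intro!: PH simp del: of_int_add)
    ultimately show ?thesis using P2[of t] by simp
  qed
  have colon_eq: "icolon (ipow I (nat t)) J = ipow I (nat (t - 1))" if "n + 2 \<le> t" for t
  proof -
    have "of_int (L (icolon (ipow I (nat t)) J)) = (of_int (?H (t - 1)) :: rat)"
      using colon_P[of t] PH[of "t - 1"] that by simp
    then show ?thesis using colon_eq_iff by simp
  qed
  have "L (icolon (ipow I (nat (n + 1))) J) \<noteq> ?H n"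
    using colon_P[of "n + 1"] PH_n by auto
  then have colon_ne: "icolon (ipow I (nat (n + 1))) J \<noteq> ipow I (nat n)"
    using colon_eq_iff[of "n + 1"] by simp
  \<comment> \<open>From \<open>0 \<le> r \<le> n + 1\<close> only \<open>n = 0\<close> and
    \<open>n = -1\<close> must be excluded; there both \<open>(I^(n+1) : J)\<close> and
    \<open>I^n\<close> are the whole ring, against \<open>colon_ne\<close>. Positivity of
    \<open>n\<close> allows \<open>F (nat n)\<close> to be read as a Ratliff-Rush closure.\<close>
  have n1: "1 \<le> n"
  proof (rule ccontr)
    assume "\<not> 1 \<le> n"
    then have "n = 0 \<or> n = - 1" using r_n by linarith
    moreover have "icolon I J = UNIV" using J_I ideal_mult_left[OF I_ideal] by (auto simp: icolon_def)
    moreover have "icolon UNIV J = UNIV" by (auto simp: icolon_def)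
    ultimately show False using colon_ne by (auto simp: iprod_UNIV I_ideal)
  qed
  have "F k = ipow I k" if k: "n + 1 \<le> int k" for k
  proof -
    \<comment> \<open>Descending induction from \<open>max N k\<close>: if \<open>I^(i+1)\<close> is
      closed, then \<open>F i\<close> multiplies \<open>J\<close> into \<open>I^(i+1)\<close>, so it
      lies in \<open>(I^(i+1) : J) = I^i\<close>.\<close>
    have "int i \<ge> n + 1 \<Longrightarrow> i \<le> max N k \<Longrightarrow> F i = ipow I i" for i
    proof (induction "max N k - i" arbitrary: i)
      case 0
      then show ?case using N by simp
    next
      case (Suc d)
      then have IH: "F (Suc i) = ipow I (Suc i)" by simp
      have "F i \<subseteq> icolon (ipow I (Suc i)) J"
        using F_mult[of _ i] J_I unfolding IH icolon_def by blast
      also have "\<dots> = ipow I i"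
        using colon_eq[of "int (Suc i)"] Suc(3) by (simp only: nat_int) (simp del: ipow.simps)
      finally show ?case using ipow_subset_F by blast
    qed
    then show ?thesis using k by simp
  qed
  then have rr: "ratliff_rush (ipow I k) = ipow I k" if "n + 1 \<le> int k" for k
    using ratliff_rush_eq_F[of k] that n1 by simp
  have "\<not> icolon (ipow I (nat (n + 1))) J \<subseteq> ipow I (nat n)"
    using colon_ne ipow_subset_colon[of "n + 1"] by auto
  moreover have "nat (n + 1) = Suc (nat n)" using n1 by simp
  ultimately have "F (nat n) \<noteq> ipow I (nat n)" using colon_subset_F[of "nat n"] by auto
  then have rr_n: "ratliff_rush (ipow I (nat n)) \<noteq> ipow I (nat n)" using ratliff_rush_eq_F[of "nat n"] n1 by simp
  have "rr_index I = nat (n + 1)"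
    unfolding rr_index_def
  proof (rule Least_equality)
    show "nat (n + 1) \<ge> 1 \<and> (\<forall>k\<ge>nat (n + 1). ratliff_rush (ipow I k) = ipow I k)"
      using rr n1 by auto
    fix i assume i: "i \<ge> 1 \<and> (\<forall>k\<ge>i. ratliff_rush (ipow I k) = ipow I k)"
    show "nat (n + 1) \<le> i"
    proof (rule ccontr)
      assume "\<not> nat (n + 1) \<le> i"
      then have "i \<le> nat n" by linarith
      then show False using i rr_n by blast
    qed
  qed
  then show False using ne n1 by (simp add: n_def)
qed

end

theorem theorem3p4:
  fixes m I :: "'a::comm_ring_1 set" and x :: 'a
  assumes "cohen_macaulay_local m"
    and "krull_dim TYPE('a) = 2"
    and "infinite_residue_field m"
    and "primary_to m I"
    and "superficial I x"
    and "postulation I \<noteq> int (rr_index I) - 1"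
  shows "int (reduction_number I) \<ge> postulation I + 2"
proof -
  obtain p q where "cm2_local m p q" using cm2_local_exists[OF assms(1-3)] by blast
  then interpret cm2_local m p q .
  have I: "is_ideal I" "I \<noteq> UNIV" "radical I = m" using assms(4) by (auto simp: primary_to_def)
  have fin: "finite_colength I"
    using I(1) pm qm unfolding finite_colength_def I(3)[symmetric] radical_def by blast
  have I_m: "I \<subseteq> m" by (rule ideal_subset_m[OF I(1,2)])
  obtain a b where J: "ideal_gen {a, b} \<subseteq> I"
    and red: "iprod (ideal_gen {a, b}) (ipow I (reduction_number I)) = ipow I (Suc (reduction_number I))"
    using reduction_number_attained[OF fin I_m] by blast
  \<comment> \<open>The reduction contains a power of \<open>I\<close>, so it has finite colength
    and its Koszul relations are trivial.\<close>
  have "ipow I (Suc (reduction_number I)) \<subseteq> ideal_gen {a, b}"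
    unfolding red[symmetric] by (rule iprod_subset_left[OF ideal_gen_ideal])
  then have "finite_colength (ideal_gen {a, b})"
    by (rule finite_colength_mono[OF finite_colength_ipow[OF fin] ideal_gen_ideal])
  then interpret koszul_pair a b by (rule finite_colength_koszul)
  interpret pair_reduction m p q a b I "reduction_number I"
    by unfold_locales (use fin I_m J red in auto)
  show ?thesis using postulation_bound[OF assms(5,6)] .
qed

end
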